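(* ($q$-Gevrey theorem of Borel–Ritt.) Let $q\in\mathbf{C}$, $|q|>1$, and let $\Lambda=\nu_1[\lambda_1]+\cdots+\nu_m[\lambda_m]$ be a divisor of degree $\nu=|\Lambda|\geq 1$. The map $J$ sending $f\in\mathbb{A}_q^\Lambda$ to its asymptotic expansion is a surjective linear map from the $\mathbf{C}$-vector space $\mathbb{A}_q^\Lambda$ onto the $\mathbf{C}$-vector space $\mathbf{C}[[z]]_{q;1/\nu}$.
   Context: For $\lambda\in\mathbf{C}^*$, $[\lambda]=\lambda q^{\mathbf{Z}}$. A divisor is a finite formal sum $\Lambda=\sum_{i=1}^m\nu_i[\lambda_i]$ with $\nu_i\in\mathbf{N}^*$ and the $[\lambda_i]$ pairwise distinct; $|\Lambda|=\sum\nu_i$. Put $d_q(z,[\lambda])=\inf_{\xi\in[\lambda]}|1-z/\xi|$, $d_q(z,\Lambda)=\prod_i d_q(z,[\lambda_i])^{\nu_i}$ and, for $\epsilon\ge0$, $R>0$, $S(\Lambda,\epsilon;R)=\{z\in\mathbf{C}^*: d_q(z,\Lambda)>\epsilon,\ |z|<R\}$. $\mathbb{B}^\Lambda$ is the set of (germs of) functions $f$ analytic on some $S(\Lambda,0;R)$, $R>0$, and such that $\sup_{S(\Lambda,\epsilon;r)}|f|<\infty$ for all $\epsilon>0$ and $r\in(0,R)$. $\mathbb{A}_q^\Lambda$ is the set of $f\in\mathbb{B}^\Lambda$ for which there are a power series $\sum_{n\ge0}a_nz^n$ and constants $C,A>0$ such that, for some small enough $R>0$, for all $\epsilon>0$,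 all integers $N\ge0$ and all $z\in S(\Lambda,\epsilon;R)$: $$\Bigl|f(z)-\sum_{0\le n<N}a_nz^n\Bigr|<\frac{C}{\epsilon}A^N|q|^{N^2/(2\nu)}|z|^N.$$ Then $J(f):=\sum a_nz^n$. For $s\ge0$, $\mathbf{C}[[z]]_{q;s}$ is the space of $\sum a_nz^n\in\mathbf{C}[[z]]$ such that $a_n=O(A^n|q|^{sn^2/2})$ for some $A>0$. *)

theory Defs
  imports
    "HOL-Analysis.Analysis"
    "HOL-Library.Multiset"
    "HOL-Library.Landau_Symbols"
    "HOL-Computational_Algebra.Formal_Power_Series"
    "Jordan_Normal_Form.VS_Connect"
begin

definition q_class :: "complex \<Rightarrow> complex \<Rightarrow> complex set" where
  "q_class q l = {l * q powi k | k :: int. True}"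

text \<open>
  A divisor, i.e. a finite formal sum of pairwise distinct classes with positive integer
  multiplicities, is a finite multiset of classes: \<open>count \<Lambda> L\<close> is the multiplicity of \<open>L\<close>,
  and \<open>size \<Lambda>\<close> is the degree of \<open>\<Lambda>\<close>.
\<close>

definition q_divisor :: "complex \<Rightarrow> complex set multiset \<Rightarrow> bool" where
  "q_divisor q \<Lambda> \<longleftrightarrow> (\<forall>L \<in># \<Lambda>. \<exists>l. l \<noteq> 0 \<and> L = q_class q l)"

definition dq_class :: "complex \<Rightarrow> complex set \<Rightarrow> real" where
  "dq_class z L = (INF \<xi>\<in>L. norm (1 - z / \<xi>))"

definition dq :: "complex \<Rightarrow> complex set multiset \<Rightarrow> real" where
  "dq z \<Lambda> = (\<Prod>L \<in> set_mset \<Lambda>. dq_class z L ^ count \<Lambda> L)"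

definition q_sector :: "complex set multiset \<Rightarrow> real \<Rightarrow> real \<Rightarrow> complex set" where
  "q_sector \<Lambda> \<epsilon> R = {z. z \<noteq> 0 \<and> dq z \<Lambda> > \<epsilon> \<and> norm z < R}"

text \<open>
  Germs are represented by total functions; only the values on some \<open>q_sector \<Lambda> 0 R\<close> matter.
  Both sets below are closed under changing a function outside such a set.
\<close>

definition B_funs :: "complex set multiset \<Rightarrow> (complex \<Rightarrow> complex) set" where
  "B_funs \<Lambda> = {f. \<exists>R>0. f analytic_on q_sector \<Lambda> 0 R \<and>
     (\<forall>\<epsilon>>0. \<forall>r\<in>{0<..<R}. bounded (f ` q_sector \<Lambda> \<epsilon> r))}"

definition has_q_expansion ::
  "complex \<Rightarrow> complex set multiset \<Rightarrow> (complex \<Rightarrow> complex) \<Rightarrow> complex fps \<Rightarrow> bool" where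
  "has_q_expansion q \<Lambda> f a \<longleftrightarrow>
     (\<exists>C>0. \<exists>A>0. \<exists>R>0. \<forall>\<epsilon>>0. \<forall>N::nat. \<forall>z\<in>q_sector \<Lambda> \<epsilon> R.
        norm (f z - (\<Sum>n<N. fps_nth a n * z ^ n))
          < C / \<epsilon> * A ^ N * norm q powr (real N ^ 2 / (2 * real (size \<Lambda>))) * norm z ^ N)"

definition A_funs :: "complex \<Rightarrow> complex set multiset \<Rightarrow> (complex \<Rightarrow> complex) set" where
  "A_funs q \<Lambda> = {f \<in> B_funs \<Lambda>. \<exists>a. has_q_expansion q \<Lambda> f a}"

definition q_germ :: "complex set multiset \<Rightarrow> (complex \<Rightarrow> complex) \<Rightarrow> (complex \<Rightarrow> complex) set" where
  "q_germ \<Lambda> f = {g. \<exists>R>0. \<forall>z\<in>q_sector \<Lambda> 0 R. g z = f z}"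

text \<open>
  The records below are vector spaces over \<open>class_ring\<close>, the complex numbers viewed as a
  ring record. The fields \<open>mult\<close> and \<open>one\<close>, present in every module record, play no role.
\<close>

definition A_space :: "complex \<Rightarrow> complex set multiset \<Rightarrow> (complex, (complex \<Rightarrow> complex) set) module" where
  "A_space q \<Lambda> = \<lparr>
     carrier = q_germ \<Lambda> ` A_funs q \<Lambda>,
     mult = undefined,
     one = undefined,
     zero = q_germ \<Lambda> (\<lambda>z. 0),
     add = (\<lambda>F G. \<Union>f\<in>F. \<Union>g\<in>G. q_germ \<Lambda> (\<lambda>z. f z + g z)),
     smult = (\<lambda>c F. \<Union>f\<in>F. q_germ \<Lambda> (\<lambda>z. c * f z))\<rparr>"

definition q_gevrey_space :: "complex \<Rightarrow> real \<Rightarrow> (complex, complex fps) module" where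
  "q_gevrey_space q s = \<lparr>
     carrier = {a. \<exists>A>0. (\<lambda>n. norm (fps_nth a n)) \<in> O(\<lambda>n. A ^ n * norm q powr (s * real n ^ 2 / 2))},
     mult = undefined,
     one = undefined,
     zero = 0,
     add = (+),
     smult = (\<lambda>c a. fps_const c * a)\<rparr>"

definition J :: "complex \<Rightarrow> complex set multiset \<Rightarrow> (complex \<Rightarrow> complex) set \<Rightarrow> complex fps" where
  "J q \<Lambda> F = (THE a. \<exists>f\<in>F. has_q_expansion q \<Lambda> f a)"

end

theory Submission
  imports Defs
begin

text \<open>
  Write \<open>\<nu>\<close> for the degree of the divisor. Multiplying theta functions one obtains a Laurent series
  \<open>T(z) = \<Sum>\<^bsub>k\<in>\<int>\<^esub> t\<^sub>k z\<^sup>k\<close> on the punctured plane with zeros exactly along the divisor and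
  \<open>T(q z) = c z\<^sup>\<nu> T(z)\<close>. On coefficients this says \<open>q\<^sup>k t\<^sub>k = c t\<^bsub>k-\<nu>\<^esub>\<close>, so \<open>|t\<^sub>k|\<close> decays like the
  weights \<open>w\<^sub>k = exp (b k - L k\<^sup>2)\<close> with \<open>L = ln |q| / (2 \<nu>)\<close>; and since \<open>|T(z)|\<close> and
  \<open>\<Theta>(|z|) = \<Sum> w\<^sub>k |z|\<^sup>k\<close> obey the same functional equation, \<open>|T| \<ge> \<delta> d\<^sub>q \<Theta>\<close> everywhere as soon as
  this holds on one annulus. Given a \<open>q\<close>-Gevrey series \<open>\<Sum> a\<^sub>n z\<^sup>n\<close>, the coefficient
  \<open>\<Sum>\<^sub>n a\<^sub>n t\<^bsub>m-n\<^esub>\<close> of \<open>z\<^sup>m\<close> in the formal product with \<open>T\<close> converges for \<open>m \<le> -M\<close>. With \<open>P\<close> the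
  part of the product of those degrees, \<open>P / T\<close> is the required preimage: the coefficients of
  \<open>P - T \<Sum>\<^bsub>n<N\<^esub> a\<^sub>n z\<^sup>n\<close> are at most \<open>C A\<^sup>N exp (L N\<^sup>2) w\<^bsub>m-N\<^esub>\<close>, whence this difference is bounded
  by \<open>C A\<^sup>N exp (L N\<^sup>2) |z|\<^sup>N \<Theta>(|z|)\<close>.
  Uniqueness of expansions is tested along a sequence \<open>z q\<^sup>-\<^sup>k\<close>, on which \<open>d\<^sub>q\<close> is constant.
\<close>

section \<open>Laurent series with Gaussian coefficients\<close>

definition theta_weight :: "real \<Rightarrow> real \<Rightarrow> int \<Rightarrow> real" where
  "theta_weight b L k = exp (b * of_int k - L * (of_int k)\<^sup>2)"

definition Theta :: "real \<Rightarrow> real \<Rightarrow> real \<Rightarrow> real" where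
  "Theta b L r = (\<Sum>\<^sub>\<infinity>k. theta_weight b L k * r powi k)"

lemma theta_weight_pos: "theta_weight b L k > 0"
  by (simp add: theta_weight_def)

lemma UNIV_int_eq: "(UNIV :: int set) = range int \<union> range (\<lambda>n. - int n - 1)"
proof -
  have "k \<in> range int \<union> range (\<lambda>n. - int n - 1)" for k
  proof (cases "k \<ge> 0")
    case True
    hence "k = int (nat k)" by simp
    thus ?thesis by blast
  next
    case False
    hence "k = - int (nat (- k - 1)) - 1" by simp
    thus ?thesis by blast
  qed
  thus ?thesis by blast
qed

text \<open>The reindexing \<open>- int n - 1\<close> starts the negative half at -1, so the two
  ranges are disjoint and cover the integers.\<close>

lemma has_sum_int:
  fixes f :: "int \<Rightarrow> 'a :: topological_ab_group_add"
  assumes "((\<lambda>n::nat. f (int n)) has_sum a) UNIV" "((\<lambda>n::nat. f (- int n - 1)) has_sum b) UNIV"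
  shows "(f has_sum (a + b)) UNIV"
proof -
  have "(f has_sum a) (range int)"
    using assms(1) by (subst has_sum_reindex) (auto simp: o_def)
  moreover have "(f has_sum b) (range (\<lambda>n. - int n - 1))"
    using assms(2) by (subst has_sum_reindex) (auto simp: o_def inj_on_def)
  moreover have "range int \<inter> range (\<lambda>n. - int n - 1) = {}" by auto
  ultimately show ?thesis
    unfolding UNIV_int_eq by (rule has_sum_Un_disjoint)
qed

lemma summable_on_half_power_abs: "(\<lambda>k::int. (1/2::real) ^ nat \<bar>k\<bar>) summable_on UNIV"
proof -
  have "(\<lambda>n::nat. (1/2::real) ^ n) summable_on UNIV"
    by (subst summable_on_UNIV_nonneg_real_iff) (auto intro: summable_geometric)
  moreover have "(\<lambda>n::nat. (1/2::real) ^ Suc n) summable_on UNIV"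
    by (subst summable_on_UNIV_nonneg_real_iff) (auto intro!: summable_mult summable_geometric)
  moreover have "nat \<bar>- int n - 1\<bar> = Suc n" for n by linarith
  ultimately show ?thesis
    unfolding summable_on_def
    using has_sum_int[of "\<lambda>k::int. (1/2::real) ^ nat \<bar>k\<bar>"] by (fastforce simp del: power_Suc)
qed

text \<open>A radius only shifts the linear coefficient by \<open>ln r\<close>; summability at
  radius \<open>r\<close> thus reduces to radius 1.\<close>

lemma theta_weight_mult_powi:
  assumes "r > 0"
  shows "theta_weight b L k * r powi k = theta_weight (b + ln r) L k"
proof -
  have "r powi k = exp (of_int k * ln r)"
    using assms by (simp add: powr_real_of_int' [symmetric] powr_def)
  thus ?thesis by (simp add: theta_weight_def algebra_simps flip: exp_add)
qed

text \<open>Completing the square bounds the exponent by a constant minus \<open>ln 2\<close> times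
  the absolute value of \<open>k\<close>, which gives comparison with a geometric series in both
  directions.\<close>

lemma theta_weight_summable:
  assumes "L > 0"
  shows "theta_weight b L summable_on UNIV"
proof (rule summable_on_comparison_test)
  \<comment> \<open>The extra \<open>ln 2\<close> survives as the factor
    \<open>(1/2) ^ nat \<bar>k\<bar>\<close> once \<open>M * x - L * x^2\<close> is bounded by its
    maximum.\<close>
  define M where "M = \<bar>b\<bar> + ln 2"
  show "(\<lambda>k. exp (M\<^sup>2 / (4 * L)) * (1/2::real) ^ nat \<bar>k\<bar>) summable_on UNIV"
    by (intro summable_on_cmult_right summable_on_half_power_abs)
  show "theta_weight b L k \<le> exp (M\<^sup>2 / (4 * L)) * (1/2::real) ^ nat \<bar>k\<bar>" for k
  proof -
    define x :: real where "x = of_int \<bar>k\<bar>"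
    have "b * of_int k \<le> \<bar>b * of_int k\<bar>" by simp
    also have "\<dots> = \<bar>b\<bar> * x" by (simp add: abs_mult x_def)
    finally have 1: "b * of_int k \<le> \<bar>b\<bar> * x" .
    have "0 \<le> (2 * L * x - M)\<^sup>2 / (4 * L)" using assms by simp
    also have "\<dots> = L * x\<^sup>2 - M * x + M\<^sup>2 / (4 * L)"
      using assms by (simp add: field_simps power2_eq_square)
    finally have 2: "M * x - L * x\<^sup>2 \<le> M\<^sup>2 / (4 * L)" by simp
    have "x\<^sup>2 = (of_int k)\<^sup>2" by (simp add: x_def)
    hence "b * of_int k - L * (of_int k)\<^sup>2 \<le> M\<^sup>2 / (4 * L) - x * ln 2"
      using 1 2 by (simp add: M_def algebra_simps)
    moreover have "exp (- (x * ln 2)) = (1/2::real) ^ nat \<bar>k\<bar>"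
    proof -
      have "x = real (nat \<bar>k\<bar>)" by (simp add: x_def)
      hence "exp (- (x * ln 2)) = exp (real (nat \<bar>k\<bar>) * ln (1/2::real))"
        by (simp add: ln_div)
      also have "\<dots> = (1/2) ^ nat \<bar>k\<bar>" by (subst exp_of_nat_mult) simp
      finally show ?thesis .
    qed
    ultimately show ?thesis
      unfolding theta_weight_def by (metis diff_conv_add_uminus exp_add exp_le_cancel_iff)
  qed
qed (auto simp: theta_weight_def)

lemma theta_weight_powi_summable:
  assumes "L > 0" "r > 0"
  shows "(\<lambda>k. theta_weight b L k * r powi k) summable_on UNIV"
  using theta_weight_summable[OF assms(1)] assms(2) by (simp add: theta_weight_mult_powi)

text \<open>The term \<open>k = 0\<close> equals 1 and the others are positive. This makes
  \<open>Theta\<close> positive for divisions and lets it be dropped from lower bounds.\<close>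

lemma Theta_ge_1:
  assumes "L > 0" "r > 0"
  shows "Theta b L r \<ge> 1"
proof -
  have "(\<Sum>k\<in>{0}. theta_weight b L k * r powi k) \<le> Theta b L r"
    unfolding Theta_def using assms
    by (intro finite_sum_le_infsum theta_weight_powi_summable)
       (auto intro!: mult_nonneg_nonneg less_imp_le[OF theta_weight_pos])
  thus ?thesis by (simp add: theta_weight_def)
qed

text \<open>Each term is compared with the corresponding term of \<open>Theta\<close>, so later
  estimates of functions reduce to estimates of coefficients.\<close>

lemma laurent_weight_bound:
  fixes t :: "int \<Rightarrow> complex"
  assumes "L > 0" "z \<noteq> 0" "\<And>k. norm (t k) \<le> K * theta_weight b L k"
  shows "(\<lambda>k. norm (t k * z powi k)) summable_on UNIV"
    and "norm (\<Sum>\<^sub>\<infinity>k. t k * z powi k) \<le> K * Theta b L (norm z)"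
proof -
  have sm: "(\<lambda>k. K * (theta_weight b L k * norm z powi k)) summable_on UNIV"
    using assms by (intro summable_on_cmult_right theta_weight_powi_summable) auto
  have le: "norm (t k * z powi k) \<le> K * (theta_weight b L k * norm z powi k)" for k
    using mult_right_mono[OF assms(3)[of k], of "norm z powi k"]
    by (simp add: norm_mult norm_power_int mult_ac)
  show *: "(\<lambda>k. norm (t k * z powi k)) summable_on UNIV"
    by (rule summable_on_comparison_test[OF sm]) (use le in auto)
  have "norm (\<Sum>\<^sub>\<infinity>k. t k * z powi k) \<le> (\<Sum>\<^sub>\<infinity>k. norm (t k * z powi k))"
    by (rule norm_infsum_bound[OF *])
  also have "\<dots> \<le> (\<Sum>\<^sub>\<infinity>k. K * (theta_weight b L k * norm z powi k))"
    by (intro infsum_mono * sm le)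
  also have "\<dots> = K * Theta b L (norm z)"
    by (simp add: Theta_def infsum_cmult_right')
  finally show "norm (\<Sum>\<^sub>\<infinity>k. t k * z powi k) \<le> K * Theta b L (norm z)" .
qed

text \<open>The series splits as A(z) + B(1/z)/z into nonnegative and negative powers. Convergence
  at every nonzero point makes both \<open>A\<close> and \<open>B\<close> entire.\<close>

lemma laurent_holomorphic:
  fixes t :: "int \<Rightarrow> complex"
  assumes sm: "\<And>z. z \<noteq> 0 \<Longrightarrow> (\<lambda>k. norm (t k * z powi k)) summable_on UNIV"
  shows "(\<lambda>z. \<Sum>\<^sub>\<infinity>k. t k * z powi k) holomorphic_on - {0}"
proof -
  have entire: "(\<lambda>z. \<Sum>n. c n * z ^ n) holomorphic_on UNIV"
    if "\<And>z. z \<noteq> 0 \<Longrightarrow> summable (\<lambda>n. c n * z ^ n)" for c :: "nat \<Rightarrow> complex"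
  proof -
    have "summable (\<lambda>n. c n * z ^ n)" for z
      using that by (cases "z = 0") auto
    from termdiffs_strong_converges_everywhere[OF this] show ?thesis
      unfolding holomorphic_on_def field_differentiable_def by (metis has_field_derivative_at_within)
  qed
  have sub: "(\<lambda>n. norm (t (g n) * z powi g n)) summable_on (UNIV :: nat set)"
    if "z \<noteq> 0" "inj g" for z and g :: "nat \<Rightarrow> int"
    using summable_on_reindex[OF that(2), of "\<lambda>k. norm (t k * z powi k)"]
      summable_on_subset[OF sm[OF that(1)], of "range g"] by (simp add: o_def)
  have sP: "(\<lambda>n. norm (t (int n) * z ^ n)) summable_on UNIV" if "z \<noteq> 0" for z
    using sub[OF that, of int] by (simp add: power_int_def)
  have pw: "z powi (- int n - 1) = (1 / z) * (1 / z) ^ n" if "z \<noteq> 0" for z :: complex and n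
    using that by (simp add: power_int_diff power_int_minus power_divide field_simps)
  have sN: "(\<lambda>n. norm (t (- int n - 1) * ((1 / z) * (1 / z) ^ n))) summable_on UNIV" if "z \<noteq> 0" for z
    using sub[OF that, of "\<lambda>n. - int n - 1"] unfolding pw[OF that] by (simp add: inj_on_def)
  define A where "A = (\<lambda>z. \<Sum>n. t (int n) * z ^ n)"
  define B where "B = (\<lambda>z. \<Sum>n. t (- int n - 1) * z ^ n)"
  have smP: "summable (\<lambda>n. t (int n) * z ^ n)" if "z \<noteq> 0" for z
    by (rule summable_on_imp_summable, rule abs_summable_summable, rule sP[OF that])
  have sN': "summable (\<lambda>n. t (- int n - 1) * ((1 / z) * (1 / z) ^ n))" if "z \<noteq> 0" for z
    by (rule summable_on_imp_summable, rule abs_summable_summable, rule sN[OF that])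
  \<comment> \<open>Substituting \<open>1 / z\<close> into \<open>sN'\<close> turns the negative
    half into an ordinary power series, up to one factor \<open>z\<close>.\<close>
  have smN: "summable (\<lambda>n. t (- int n - 1) * z ^ n)" if "z \<noteq> 0" for z
    using summable_mult[OF sN'[of "1 / z"], of "1 / z"] that by (simp add: field_simps)
  have "(\<Sum>\<^sub>\<infinity>k. t k * z powi k) = A z + B (1 / z) / z" if z: "z \<noteq> 0" for z
  proof -
    have "((\<lambda>n. t (int n) * z powi int n) has_sum A z) UNIV"
      using sP[OF z] smP[OF z] unfolding A_def
      by (intro norm_summable_imp_has_sum) (auto intro: summable_on_imp_summable)
    moreover have "((\<lambda>n. t (- int n - 1) * z powi (- int n - 1)) has_sum (B (1 / z) / z)) UNIV"
    proof (rule norm_summable_imp_has_sum)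
      show "summable (\<lambda>n. norm (t (- int n - 1) * z powi (- int n - 1)))"
        using sN[OF z] unfolding pw[OF z] by (rule summable_on_imp_summable)
      have "(\<lambda>n. t (- int n - 1) * (1 / z) ^ n * (1 / z)) sums (B (1 / z) * (1 / z))"
        unfolding B_def using z by (intro sums_mult2 summable_sums smN) auto
      thus "(\<lambda>n. t (- int n - 1) * z powi (- int n - 1)) sums (B (1 / z) / z)"
        unfolding pw[OF z] by (simp add: mult_ac)
    qed
    ultimately show ?thesis
      by (intro infsumI has_sum_int)
  qed
  moreover have "(\<lambda>z. A z + B (1 / z) / z) holomorphic_on - {0}"
  proof -
    have "A holomorphic_on UNIV" "B holomorphic_on UNIV"
      unfolding A_def B_def using smP smN by (auto intro: entire)
    moreover from this(2) have "B \<circ> (\<lambda>z. 1 / z) holomorphic_on - {0}"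
      by (intro holomorphic_on_compose[OF _ holomorphic_on_subset]) (auto intro!: holomorphic_intros)
    ultimately show ?thesis
      by (intro holomorphic_intros) (auto simp: o_def intro: holomorphic_on_subset)
  qed
  ultimately show ?thesis
    by (subst holomorphic_cong[OF refl]) auto
qed

text \<open>The recurrence is applied term by term, and the index shift by \<open>\<nu>\<close>
  pulls out \<open>z ^ \<nu>\<close>. The field is general because the identity is used for the
  complex series and for the real series \<open>Theta\<close>.\<close>

lemma laurent_functional_equation:
  fixes t :: "int \<Rightarrow> 'a :: real_normed_field"
  assumes "z \<noteq> 0" and rec: "\<And>k. q powi k * t k = c * t (k - int \<nu>)"
  shows "(\<Sum>\<^sub>\<infinity>k. t k * (q * z) powi k) = c * z ^ \<nu> * (\<Sum>\<^sub>\<infinity>k. t k * z powi k)"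
proof -
  have "(\<Sum>\<^sub>\<infinity>k. t k * (q * z) powi k) = (\<Sum>\<^sub>\<infinity>k. c * z ^ \<nu> * (t (k - int \<nu>) * z powi (k - int \<nu>)))"
  proof (rule infsum_cong)
    fix k
    have "t k * (q * z) powi k = c * t (k - int \<nu>) * z powi k"
      by (simp add: power_int_mult_distrib mult_ac flip: rec)
    also have "z powi k = z ^ \<nu> * z powi (k - int \<nu>)"
      using assms(1) by (simp add: power_int_diff)
    finally show "t k * (q * z) powi k = c * z ^ \<nu> * (t (k - int \<nu>) * z powi (k - int \<nu>))"
      by (simp add: mult_ac)
  qed
  also have "\<dots> = c * z ^ \<nu> * (\<Sum>\<^sub>\<infinity>k. t (k - int \<nu>) * z powi (k - int \<nu>))"
    by (rule infsum_cmult_right')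
  also have "bij (\<lambda>k. k - int \<nu>)"
    by (rule bij_betw_byWitness[of _ "\<lambda>k. k + int \<nu>"]) auto
  from infsum_reindex_bij_betw[OF this, of "\<lambda>k. t k * z powi k"]
  have "(\<Sum>\<^sub>\<infinity>k. t (k - int \<nu>) * z powi (k - int \<nu>)) = (\<Sum>\<^sub>\<infinity>k. t k * z powi k)" .
  finally show ?thesis .
qed

section \<open>Bounds from a theta recurrence\<close>

lemma int_periodic:
  fixes f :: "int \<Rightarrow> 'a"
  assumes "\<And>k. f (k + p) = f k"
  shows "f (k + p * j) = f k"
proof (induction j rule: int_induct[of _ 0])
  case (step1 i)
  thus ?case using assms[of "k + p * i"] by (simp add: algebra_simps)
next
  case (step2 i)
  thus ?case using assms[of "k + p * (i - 1)"] by (simp add: algebra_simps)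
qed auto

text \<open>
  The values of \<open>L\<close> and \<open>b\<close> are those for which the weights satisfy the same recurrence as the
  absolute values of the coefficients.
\<close>

locale theta_recurrence =
  fixes q c :: complex and \<nu> :: nat and t :: "int \<Rightarrow> complex" and b L :: real
  assumes q: "norm q > 1" and c: "c \<noteq> 0" and \<nu>: "\<nu> \<ge> 1"
    and rec: "\<And>k. q powi k * t k = c * t (k - int \<nu>)"
    and L_def: "L = ln (norm q) / (2 * real \<nu>)"
    and b_def: "b = ln (norm c) / real \<nu> - ln (norm q) / 2"
begin

lemma L_pos: "L > 0"
  using q \<nu> unfolding L_def by (intro divide_pos_pos ln_gt_zero) auto

text \<open>Comparing exponents, the linear terms require \<open>2 * L * \<nu> = ln (norm q)\<close>
  and the constant terms \<open>b * \<nu> + L * \<nu>^2 = ln (norm c)\<close>; these two equations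
  determine \<open>L\<close> and \<open>b\<close>.\<close>

lemma weight_recurrence: "norm q powi k * theta_weight b L k = norm c * theta_weight b L (k - int \<nu>)"
proof -
  have "norm q powi k = exp (of_int k * ln (norm q))"
    using q by (subst powr_real_of_int' [symmetric]) (auto simp: powr_def)
  moreover have "norm c = exp (ln (norm c))" using c by simp
  moreover have "of_int k * ln (norm q) + (b * of_int k - L * (of_int k)\<^sup>2) =
      ln (norm c) + (b * of_int (k - int \<nu>) - L * (of_int (k - int \<nu>))\<^sup>2)"
    using \<nu> by (simp add: L_def b_def field_simps power2_eq_square)
  ultimately show ?thesis
    unfolding theta_weight_def by (metis exp_add)
qed

text \<open>Coefficient norms and weights obey the same recurrence, so their ratio has period
  \<open>\<nu>\<close> and takes only finitely many values.\<close>

lemma coeff_bound: "\<exists>K>0. \<forall>k. norm (t k) \<le> K * theta_weight b L k"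
proof -
  define \<rho> where "\<rho> = (\<lambda>k. norm (t k) / theta_weight b L k)"
  have "\<rho> k = \<rho> (k - int \<nu>)" for k
  proof -
    have "norm q powi k * norm (t k) = norm c * norm (t (k - int \<nu>))"
      using arg_cong[OF rec[of k], of norm] by (simp add: norm_mult norm_power_int)
    hence "(norm q powi k * norm (t k)) / (norm q powi k * theta_weight b L k) = \<rho> (k - int \<nu>)"
      using c by (simp add: weight_recurrence \<rho>_def)
    moreover have "norm q powi k > 0" using q by (intro zero_less_power_int) auto
    hence "(norm q powi k * norm (t k)) / (norm q powi k * theta_weight b L k) = \<rho> k"
      by (simp add: \<rho>_def mult_divide_mult_cancel_left_if del: power_int_eq_0_iff)
    ultimately show ?thesis by simp
  qed
  from this[of "k + int \<nu>" for k] have "\<rho> (k + int \<nu> * j) = \<rho> k" for k j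
    by (intro int_periodic) simp
  from this[of "k mod int \<nu>" "k div int \<nu>" for k] have per: "\<rho> k = \<rho> (k mod int \<nu>)" for k
    by (simp add: mult.commute)
  \<comment> \<open>Adding 1 keeps \<open>K\<close> positive even when all coefficients
    vanish.\<close>
  define K where "K = Max (\<rho> ` {0..<int \<nu>}) + 1"
  have "\<rho> k \<le> K" for k
  proof -
    have "\<rho> (k mod int \<nu>) \<le> Max (\<rho> ` {0..<int \<nu>})"
      using \<nu> by (intro Max_ge) auto
    thus ?thesis unfolding K_def per[of k] by simp
  qed
  moreover have "\<rho> k \<ge> 0" for k
    using theta_weight_pos[of b L k] by (simp add: \<rho>_def)
  hence "K > 0"
    using Max_ge[of "\<rho> ` {0..<int \<nu>}" "\<rho> 0"] \<nu> unfolding K_def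
    by (smt (verit) atLeastLessThan_iff finite_atLeastLessThan_int finite_imageI imageI of_nat_1 of_nat_le_iff)
  moreover have "norm (t k) = \<rho> k * theta_weight b L k" for k
    using theta_weight_pos[of b L k] by (simp add: \<rho>_def)
  ultimately show ?thesis
    by (metis less_imp_le mult_right_mono theta_weight_pos)
qed

lemma Theta_functional_equation:
  assumes "r > 0"
  shows "Theta b L (norm q * r) = norm c * r ^ \<nu> * Theta b L r"
  unfolding Theta_def using assms
  by (intro laurent_functional_equation weight_recurrence) auto

text \<open>Passing from \<open>z\<close> to \<open>q * z\<close> multiplies both sides by
  \<open>norm c * norm z ^ \<nu>\<close>, since \<open>D\<close> is invariant, and a power of
  \<open>q\<close> moves every nonzero point into the annulus. \<open>D\<close> is kept abstract to
  serve both a single class and a whole divisor.\<close>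

lemma lower_bound_from_annulus:
  fixes D :: "complex \<Rightarrow> real"
  assumes D: "\<And>z. z \<noteq> 0 \<Longrightarrow> D (q * z) = D z" "\<And>z. D z \<ge> 0"
    and r: "r > 0" and \<delta>: "\<delta> > 0"
    and ann: "\<And>z. r \<le> norm z \<Longrightarrow> norm z \<le> norm q * r \<Longrightarrow>
      \<delta> * D z \<le> norm (\<Sum>\<^sub>\<infinity>k. t k * z powi k)"
  shows "\<exists>\<delta>'>0. \<forall>z. z \<noteq> 0 \<longrightarrow> \<delta>' * D z * Theta b L (norm z) \<le> norm (\<Sum>\<^sub>\<infinity>k. t k * z powi k)"
proof -
  define Q where "Q = norm q"
  have Q: "Q > 1" using q by (simp add: Q_def)
  define T where "T = (\<lambda>z. \<Sum>\<^sub>\<infinity>k. t k * z powi k)"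
  \<comment> \<open>On the annulus \<open>s powi k\<close> is at most the sum of its values at the
    two endpoints, being increasing or decreasing in \<open>s\<close> according to the sign of
    \<open>k\<close>. Hence \<open>Theta\<close> is at most \<open>M\<close> there.\<close>
  define M where "M = Theta b L r + Theta b L (Q * r)"
  have M: "M \<ge> 1"
    using Theta_ge_1[OF L_pos r, of b] Theta_ge_1[OF L_pos, of "Q * r" b] r Q by (simp add: M_def)
  have TM: "Theta b L s \<le> M" if s: "r \<le> s" "s \<le> Q * r" for s
  proof -
    have "Theta b L s \<le> (\<Sum>\<^sub>\<infinity>k. theta_weight b L k * r powi k + theta_weight b L k * (Q * r) powi k)"
      unfolding Theta_def
    proof (intro infsum_mono theta_weight_powi_summable summable_on_add L_pos)
      fix k
      have "s powi k \<le> r powi k + (Q * r) powi k"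
      proof (cases "k \<ge> 0")
        case True
        hence "s powi k \<le> (Q * r) powi k" using s r by (intro power_int_mono) auto
        thus ?thesis using r by (smt (verit) zero_le_power_int)
      next
        case False
        hence "s powi k \<le> r powi k" using s r by (intro power_int_antimono) auto
        moreover have "0 \<le> (Q * r) powi k" using r Q by (intro zero_le_power_int) auto
        ultimately show ?thesis by linarith
      qed
      from mult_left_mono[OF this less_imp_le[OF theta_weight_pos]]
      show "theta_weight b L k * s powi k \<le> theta_weight b L k * r powi k + theta_weight b L k * (Q * r) powi k"
        by (simp add: algebra_simps)
    qed (use r s Q in auto)
    also have "\<dots> = M"
      unfolding M_def Theta_def using r Q
      by (intro infsum_add theta_weight_powi_summable L_pos) auto
    finally show ?thesis .
  qed
  define P where "P = (\<lambda>z. \<delta> / M * D z * Theta b L (norm z) \<le> norm (T z))"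
  have P_ann: "P z" if "r \<le> norm z" "norm z \<le> Q * r" for z
  proof -
    have "\<delta> / M * D z * Theta b L (norm z) \<le> \<delta> / M * D z * M"
      using TM[OF that] M \<delta> D(2)[of z] by (intro mult_left_mono) auto
    also have "\<dots> = \<delta> * D z" using M by simp
    also have "\<dots> \<le> norm (T z)" using ann that by (simp add: T_def Q_def)
    finally show ?thesis by (simp add: P_def)
  qed
  have q0: "q \<noteq> 0" using q by auto
  have P_step: "P (q * z) \<longleftrightarrow> P z" if z: "z \<noteq> 0" for z
  proof -
    have "T (q * z) = c * z ^ \<nu> * T z"
      unfolding T_def by (rule laurent_functional_equation[OF z rec])
    hence "norm (T (q * z)) = norm c * norm z ^ \<nu> * norm (T z)"
      by (simp add: norm_mult norm_power)
    moreover have "Theta b L (norm (q * z)) = norm c * norm z ^ \<nu> * Theta b L (norm z)"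
      using Theta_functional_equation[of "norm z"] z by (simp add: norm_mult)
    ultimately have "P (q * z) \<longleftrightarrow> (norm c * norm z ^ \<nu>) * (\<delta> / M * D z * Theta b L (norm z))
        \<le> (norm c * norm z ^ \<nu>) * norm (T z)"
      unfolding P_def D(1)[OF z] by (simp add: mult_ac)
    also have "\<dots> \<longleftrightarrow> P z"
      unfolding P_def using z c by (subst mult_le_cancel_left_pos) auto
    finally show ?thesis .
  qed
  have P_powi: "P (q powi k * z) \<longleftrightarrow> P z" if z: "z \<noteq> 0" for z k
  proof (induction k rule: int_induct[of _ 0])
    case (step1 i)
    thus ?case using P_step[of "q powi i * z"] z q0 by (simp add: power_int_add mult_ac)
  next
    case (step2 i)
    thus ?case using P_step[of "q powi (i - 1) * z"] z q0 by (simp add: power_int_diff)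
  qed auto
  have "P z" if z: "z \<noteq> 0" for z
  proof -
    \<comment> \<open>With this exponent, \<open>q powi (- k) * z\<close> has norm between
      \<open>r\<close> and \<open>Q * r\<close>.\<close>
    define k where "k = \<lfloor>log Q (norm z / r)\<rfloor>"
    have "Q powr of_int k \<le> Q powr log Q (norm z / r)" "Q powr log Q (norm z / r) \<le> Q powr (of_int k + 1)"
      using Q by (auto simp: k_def)
    moreover have "Q powr log Q (norm z / r) = norm z / r"
      using z r Q by simp
    moreover have "Q powr of_int k = Q powi k" using Q by (intro powr_real_of_int') auto
    ultimately have "Q powi k \<le> norm z / r" "norm z / r \<le> Q * Q powi k"
      using Q by (auto simp: powr_add mult.commute)
    moreover have "norm (q powi (- k) * z) = norm z / Q powi k"
      by (simp add: norm_mult norm_inverse norm_power_int power_int_minus Q_def divide_inverse mult.commute)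
    moreover have "Q powi k > 0" using Q by (intro zero_less_power_int) auto
    ultimately have "P (q powi (- k) * z)"
      using r by (intro P_ann) (auto simp: field_simps)
    thus ?thesis using P_powi[OF z] by blast
  qed
  thus ?thesis
    using \<delta> M by (intro exI[of _ "\<delta> / M"]) (auto simp: P_def T_def)
qed

end

section \<open>The Jacobi triple product\<close>

text \<open>The q-Pochhammer symbol (p; p)_n.\<close>

definition qpoch :: "complex \<Rightarrow> nat \<Rightarrow> complex" where
  "qpoch p n = (\<Prod>i<n. 1 - p ^ Suc i)"

text \<open>The Gaussian binomial coefficient. The value 0 beyond \<open>n\<close> makes the Pascal
  rule hold at the boundary too.\<close>

definition qbinom :: "complex \<Rightarrow> nat \<Rightarrow> nat \<Rightarrow> complex" where
  "qbinom p n k = (if k \<le> n then qpoch p n / (qpoch p k * qpoch p (n - k)) else 0)"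

lemma one_minus_power_nonzero:
  fixes p :: complex
  assumes "norm p < 1"
  shows "1 - p ^ Suc i \<noteq> 0"
proof
  assume "1 - p ^ Suc i = 0"
  hence "norm p ^ Suc i = 1" by (metis eq_iff_diff_eq_0 norm_one norm_power)
  moreover have "norm p ^ Suc i \<le> norm p"
    using assms by (simp add: mult_left_le power_le_one)
  ultimately show False using assms by simp
qed

lemma qpoch_nonzero: "norm p < 1 \<Longrightarrow> qpoch p n \<noteq> 0"
  using one_minus_power_nonzero by (simp add: qpoch_def del: power_Suc)

lemma qpoch_0 [simp]: "qpoch p 0 = 1"
  by (simp add: qpoch_def)

lemma qpoch_Suc: "qpoch p (Suc n) = qpoch p n * (1 - p ^ Suc n)"
  by (simp add: qpoch_def)

lemma qbinom_0: "norm p < 1 \<Longrightarrow> qbinom p n 0 = 1"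
  using qpoch_nonzero by (simp add: qbinom_def)

text \<open>One of the two q-Pascal rules. For \<open>n = Suc (k + m)\<close> it comes from 1 - x y
  = (1 - y) + y (1 - x) with \<open>p ^ Suc k\<close> as x and \<open>p ^ Suc m\<close> as
  y.\<close>

lemma qbinom_Suc_Suc:
  assumes p: "norm p < 1" and "k \<le> n"
  shows "qbinom p (Suc n) (Suc k) = qbinom p n (Suc k) + p ^ (n - k) * qbinom p n k"
proof (cases "k = n")
  case True
  thus ?thesis using qpoch_nonzero[OF p] by (simp add: qbinom_def)
next
  case False
  define m where "m = n - Suc k"
  have m: "n = Suc (k + m)" using assms False by (simp add: m_def)
  note nz = qpoch_nonzero[OF p, of k] qpoch_nonzero[OF p, of m]
    one_minus_power_nonzero[OF p, of k] one_minus_power_nonzero[OF p, of m]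
  have 1: "p ^ Suc n = p ^ Suc k * p ^ Suc m" by (simp add: m power_add)
  have "qbinom p (Suc n) (Suc k) =
      qpoch p n * (1 - p ^ Suc k * p ^ Suc m) / (qpoch p k * (1 - p ^ Suc k) * (qpoch p m * (1 - p ^ Suc m)))"
    unfolding qbinom_def using 1 by (simp add: m qpoch_Suc Suc_diff_le del: power_Suc)
  also have "\<dots> = qpoch p n / (qpoch p k * (1 - p ^ Suc k) * qpoch p m) +
      p ^ Suc m * (qpoch p n / (qpoch p k * (qpoch p m * (1 - p ^ Suc m))))"
    using nz by (simp add: divide_simps del: power_Suc) (simp add: algebra_simps del: power_Suc)
  also have "\<dots> = qbinom p n (Suc k) + p ^ (n - k) * qbinom p n k"
    unfolding qbinom_def by (simp add: m qpoch_Suc Suc_diff_le del: power_Suc)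
  finally show ?thesis .
qed

text \<open>Induction on the number of factors: multiplication by \<open>1 + x * p ^ n\<close> acts
  on the coefficients as the q-Pascal rule.\<close>

theorem q_binomial:
  assumes p: "norm p < 1"
  shows "(\<Prod>i<n. 1 + x * p ^ i) = (\<Sum>k\<le>n. p ^ (k choose 2) * qbinom p n k * x ^ k)"
proof (induction n)
  case 0
  thus ?case by (simp add: qbinom_0 p numeral_2_eq_2)
next
  case (Suc n)
  let ?f = "\<lambda>n k. p ^ (k choose 2) * qbinom p n k * x ^ k"
  have "(\<Sum>k\<le>Suc n. ?f (Suc n) k) = ?f (Suc n) 0 + (\<Sum>k\<le>n. ?f (Suc n) (Suc k))"
    by (rule sum.atMost_Suc_shift)
  also have "(\<Sum>k\<le>n. ?f (Suc n) (Suc k)) = (\<Sum>k\<le>n. ?f n (Suc k) + x * p ^ n * ?f n k)"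
  proof (rule sum.cong)
    fix k assume "k \<in> {..n}"
    hence k: "k \<le> n" by simp
    have *: "p ^ n = p ^ k * p ^ (n - k)" using k by (simp flip: power_add)
    show "?f (Suc n) (Suc k) = ?f n (Suc k) + x * p ^ n * ?f n k"
      unfolding qbinom_Suc_Suc[OF p k] *
      by (simp add: numeral_2_eq_2 power_add algebra_simps)
  qed simp
  also have "\<dots> = (\<Sum>k\<le>n. ?f n (Suc k)) + x * p ^ n * (\<Sum>k\<le>n. ?f n k)"
    by (simp add: sum.distrib sum_distrib_left)
  also have "?f (Suc n) 0 + \<dots> = (?f n 0 + (\<Sum>k\<le>n. ?f n (Suc k))) + x * p ^ n * (\<Sum>k\<le>n. ?f n k)"
    by (simp add: qbinom_0 p)
  also have "?f n 0 + (\<Sum>k\<le>n. ?f n (Suc k)) = (\<Sum>k\<le>Suc n. ?f n k)"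
    by (rule sum.atMost_Suc_shift [symmetric])
  \<comment> \<open>The top summand vanishes because \<open>qbinom p n (Suc n)\<close> is 0.\<close>
  also have "\<dots> = (\<Sum>k\<le>n. ?f n k)" by (simp add: qbinom_def)
  finally show ?case using Suc by (simp add: algebra_simps)
qed

text \<open>The coefficients of Jacobi's theta series. A product of consecutive integers is even, so
  the division is exact.\<close>

definition jacobi_coeff :: "complex \<Rightarrow> int \<Rightarrow> complex" where
  "jacobi_coeff p k = (-1) powi k * p powi (k * (k - 1) div 2)"


text \<open>Collects the powers of \<open>p\<close> that arise when the q-binomial sum of order
  \<open>2 * n\<close> is recentred at its middle index.\<close>

lemma triangular_exponent:
  "int (k choose 2) - int n * int k + int (Suc n choose 2) = (int k - int n) * (int k - int n - 1) div 2"
proof -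
  have two: "2 * int (m choose 2) = int m * (int m - 1)" for m
  proof (induction m)
    case (Suc m)
    thus ?case by (simp add: numeral_2_eq_2 algebra_simps)
  qed simp
  have "2 * (int (k choose 2) - int n * int k + int (Suc n choose 2)) =
      (int k - int n) * (int k - int n - 1)"
    using two[of k] two[of "Suc n"] by (simp add: algebra_simps)
  thus ?thesis by (metis nonzero_mult_div_cancel_left zero_neq_numeral)
qed

lemma prod_lessThan_add:
  fixes f :: "nat \<Rightarrow> 'a :: comm_monoid_mult"
  shows "(\<Prod>i<m + n. f i) = (\<Prod>i<m. f i) * (\<Prod>i<n. f (m + i))"
  by (induction n) (auto simp: mult_ac)

text \<open>This is the q-binomial theorem of order \<open>2 * n\<close> at
  \<open>x = - w / p ^ n\<close>. The last \<open>n\<close> factors are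
  \<open>1 - w * p ^ i\<close>; the first \<open>n\<close>, in reverse order, are
  \<open>1 - w / p ^ Suc i\<close>, and pulling \<open>- w / p ^ Suc i\<close> out of each leaves
  \<open>1 - p ^ Suc i / w\<close>.\<close>

theorem finite_jacobi_triple_product:
  assumes p: "norm p < 1" "p \<noteq> 0" and w: "w \<noteq> 0"
  shows "(\<Prod>i<n. (1 - w * p ^ i) * (1 - p ^ Suc i / w)) =
    (\<Sum>k\<le>2 * n. qbinom p (2 * n) k * (jacobi_coeff p (int k - int n) * w powi (int k - int n)))"
proof -
  define x where "x = - w / p ^ n"
  define Y where "Y = (\<Prod>i<n. - w / p ^ Suc i)"
  have "(\<Prod>i<m. - w / p ^ Suc i) = (- w) ^ m / p ^ (Suc m choose 2)" for m
    using p by (induction m) (auto simp: numeral_2_eq_2 power_add field_simps)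
  hence Y: "Y = (- w) ^ n / p ^ (Suc n choose 2)" by (simp only: Y_def)
  have Y0: "Y \<noteq> 0" using p w by (simp add: Y_def)
  have "(\<Prod>i<2 * n. 1 + x * p ^ i) = (\<Prod>i<n. 1 + x * p ^ i) * (\<Prod>i<n. 1 + x * p ^ (n + i))"
    unfolding mult_2 by (rule prod_lessThan_add)
  also have "(\<Prod>i<n. 1 + x * p ^ (n + i)) = (\<Prod>i<n. 1 - w * p ^ i)"
    using p by (simp add: x_def power_add)
  also have "(\<Prod>i<n. 1 + x * p ^ i) = (\<Prod>i<n. 1 + x * p ^ (n - Suc i))"
    by (rule prod.nat_diff_reindex [symmetric])
  also have "\<dots> = (\<Prod>i<n. (- w / p ^ Suc i) * (1 - p ^ Suc i / w))"
  proof (rule prod.cong)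
    fix i assume "i \<in> {..<n}"
    hence "p ^ n = p ^ (n - Suc i) * p ^ Suc i" by (subst power_add [symmetric]) auto
    thus "1 + x * p ^ (n - Suc i) = (- w / p ^ Suc i) * (1 - p ^ Suc i / w)"
      using p w by (simp add: x_def field_simps del: power_Suc)
  qed simp
  also have "\<dots> = Y * (\<Prod>i<n. 1 - p ^ Suc i / w)"
    unfolding Y_def by (rule prod.distrib)
  finally have "(\<Prod>i<n. (1 - w * p ^ i) * (1 - p ^ Suc i / w)) = (\<Prod>i<2 * n. 1 + x * p ^ i) / Y"
    using Y0 by (simp add: prod.distrib)
  also have "\<dots> = (\<Sum>k\<le>2 * n. p ^ (k choose 2) * qbinom p (2 * n) k * x ^ k / Y)"
    by (simp add: q_binomial[OF p(1)] sum_divide_distrib)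
  also have "\<dots> = (\<Sum>k\<le>2 * n. qbinom p (2 * n) k * (jacobi_coeff p (int k - int n) * w powi (int k - int n)))"
  proof (rule sum.cong)
    fix k
    have "p ^ (k choose 2) * x ^ k / Y = ((- 1) ^ k / (- 1) ^ n) * (w ^ k / w ^ n) *
        (p ^ (k choose 2) / (p ^ n) ^ k * p ^ (Suc n choose 2))"
    proof -
      have xk: "x ^ k = (- 1) ^ k * w ^ k / (p ^ n) ^ k"
        unfolding x_def power_divide power_minus[of w] ..
      have Yn: "Y = (- 1) ^ n * w ^ n / p ^ (Suc n choose 2)"
        unfolding Y power_minus[of w] ..
      show ?thesis unfolding xk Yn using p w by (simp add: divide_simps)
    qed
    also have "(- 1) ^ k / (- 1) ^ n = ((- 1) powi (int k - int n) :: complex)"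
      by (simp add: power_int_diff)
    also have "w ^ k / w ^ n = w powi (int k - int n)"
      using w by (simp add: power_int_diff)
    also have "p ^ (k choose 2) / (p ^ n) ^ k * p ^ (Suc n choose 2) =
        p powi (int (k choose 2) - int n * int k + int (Suc n choose 2))"
      using p by (simp add: power_int_diff power_int_add flip: power_mult of_nat_mult)
    finally have "p ^ (k choose 2) * x ^ k / Y = jacobi_coeff p (int k - int n) * w powi (int k - int n)"
      unfolding triangular_exponent by (simp add: jacobi_coeff_def)
    moreover have "p ^ (k choose 2) * qbinom p (2 * n) k * x ^ k / Y =
        qbinom p (2 * n) k * (p ^ (k choose 2) * x ^ k / Y)" by simp
    ultimately show "p ^ (k choose 2) * qbinom p (2 * n) k * x ^ k / Y =
        qbinom p (2 * n) k * (jacobi_coeff p (int k - int n) * w powi (int k - int n))"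
      by simp
  qed simp
  finally show ?thesis .
qed

section \<open>The limit of the triple product and a lower bound for theta\<close>

text \<open>Absolute convergence excludes divergence to 0, so nonvanishing factors have a
  nonvanishing limit; inverses of the partial products then stay bounded.\<close>

lemma prod_one_minus_limit:
  fixes x :: "nat \<Rightarrow> 'a :: {real_normed_field, banach, heine_borel}"
  assumes "summable (\<lambda>i. norm (x i))" "\<And>i. 1 - x i \<noteq> 0"
  obtains l where "l \<noteq> 0" "(\<lambda>n. \<Prod>i<n. 1 - x i) \<longlonglongrightarrow> l"
proof -
  have "convergent_prod (\<lambda>i. 1 - x i)"
    by (intro abs_convergent_prod_imp_convergent_prod summable_imp_abs_convergent_prod)
       (use assms(1) in simp)
  with assms(2) obtain l where "(\<lambda>n. \<Prod>i\<le>n. 1 - x i) \<longlonglongrightarrow> l" "l \<noteq> 0"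
    by (subst (asm) convergent_prod_iff_nz_lim) auto
  thus ?thesis
    using that by (simp add: LIMSEQ_lessThan_iff_atMost)
qed

text \<open>For absolutely summable families \<open>infsum\<close> is the integral for the counting
  measure, so Lebesgue's theorem applies.\<close>

lemma infsum_dominated_convergence:
  fixes g :: "nat \<Rightarrow> 'b \<Rightarrow> complex"
  assumes lim: "\<And>k. (\<lambda>n. g n k) \<longlonglongrightarrow> h k"
    and bd: "\<And>n k. norm (g n k) \<le> M k" and M: "M summable_on UNIV"
  shows "(\<lambda>n. \<Sum>\<^sub>\<infinity>k. g n k) \<longlonglongrightarrow> (\<Sum>\<^sub>\<infinity>k. h k)"
proof -
  have bd': "norm (h k) \<le> M k" for k
    by (rule tendsto_upperbound[OF tendsto_norm[OF lim]]) (auto simp: bd)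
  have M0: "M k \<ge> 0" for k using bd[of 0 k] norm_ge_zero order_trans by blast
  hence "(\<lambda>k. norm (M k)) summable_on UNIV" using M by simp
  hence iM: "integrable (count_space UNIV) M"
    by (simp only: abs_summable_equivalent Infinite_Set_Sum.abs_summable_on_def)
  have eq: "integral\<^sup>L (count_space UNIV) f = (\<Sum>\<^sub>\<infinity>k. f k)" if "\<And>k. norm (f k) \<le> M k"
    for f :: "'b \<Rightarrow> complex"
  proof -
    have "(\<lambda>k. norm (f k)) summable_on UNIV"
      by (rule summable_on_comparison_test[OF M]) (use that in auto)
    thus ?thesis
      using infsetsum_infsum by (metis abs_summable_equivalent infsetsum_def)
  qed
  have "(\<lambda>n. integral\<^sup>L (count_space UNIV) (g n)) \<longlonglongrightarrow> integral\<^sup>L (count_space UNIV) h"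
    by (rule integral_dominated_convergence[where w = M]) (auto simp: iM lim bd)
  thus ?thesis by (simp add: eq bd bd')
qed

text \<open>Both parameters are the values of \<open>b\<close> and \<open>L\<close> that
  \<open>theta_recurrence\<close> prescribes for \<open>c = - q\<close> and
  \<open>\<nu> = 1\<close>.\<close>

lemma jacobi_coeff_norm:
  assumes "norm q > 1"
  shows "norm (jacobi_coeff (1 / q) k) = theta_weight (ln (norm q) / 2) (ln (norm q) / 2) k"
proof -
  have ev: "even (k * (k - 1))" by auto
  have "norm (jacobi_coeff (1 / q) k) = (1 / norm q) powi (k * (k - 1) div 2)"
    by (simp add: jacobi_coeff_def norm_mult norm_power_int norm_divide)
  also have "\<dots> = exp (of_int (k * (k - 1) div 2) * ln (1 / norm q))"
    using assms by (subst powr_real_of_int' [symmetric]) (auto simp: powr_def)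
  also have "of_int (k * (k - 1) div 2) = (of_int k * (of_int k - 1) / 2 :: real)"
    using ev by (metis of_int_1 of_int_diff of_int_mult of_int_numeral real_of_int_div)
  also have "exp (\<dots> * ln (1 / norm q)) = theta_weight (ln (norm q) / 2) (ln (norm q) / 2) k"
    using assms by (simp add: theta_weight_def ln_div field_simps power2_eq_square)
  finally show ?thesis .
qed

text \<open>Consecutive exponents k(k-1)/2 and (k-1)(k-2)/2 differ by k-1; this is the theta
  recurrence of degree one.\<close>

lemma jacobi_coeff_recurrence:
  assumes "q \<noteq> 0"
  shows "q powi k * jacobi_coeff (1 / q) k = - q * jacobi_coeff (1 / q) (k - 1)"
proof -
  have "k * (k - 1) div 2 = (k - 1) * (k - 1 - 1) div 2 + (k - 1)"
  proof -
    have "k * (k - 1) = (k - 1) * (k - 1 - 1) + 2 * (k - 1)" by (simp add: algebra_simps)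
    thus ?thesis by simp
  qed
  hence "jacobi_coeff (1 / q) k = - ((1 / q) powi (k - 1)) * jacobi_coeff (1 / q) (k - 1)"
    using assms by (simp add: jacobi_coeff_def power_int_add power_int_diff)
  moreover have "q powi k = q * q powi (k - 1)" using assms by (simp add: power_int_diff)
  moreover have "q powi (k - 1) * (1 / q) powi (k - 1) = 1"
    using assms by (simp flip: power_int_mult_distrib)
  ultimately show ?thesis by (simp add: mult_ac)
qed

text \<open>In the finite triple product the recentred Gaussian binomials are uniformly bounded and
  tend to the inverse of the limit of \<open>qpoch p\<close>, so dominated convergence applies. The
  constant obtained is that inverse, whereas \<open>l\<close> inside the proof is the limit
  itself.\<close>

lemma jacobi_theta_limit:
  assumes q: "norm q > 1"
  obtains l where "l \<noteq> 0"
    "\<And>w. w \<noteq> 0 \<Longrightarrow> (\<lambda>n. \<Prod>i<n. (1 - w * (1 / q) ^ i) * (1 - (1 / q) ^ Suc i / w)) \<longlonglongrightarrow>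
      l * (\<Sum>\<^sub>\<infinity>k. jacobi_coeff (1 / q) k * w powi k)"
proof -
  define p where "p = 1 / q"
  have p: "norm p < 1" "p \<noteq> 0" using q by (auto simp: p_def norm_divide divide_less_eq_1)
  obtain l where l: "l \<noteq> 0" "qpoch p \<longlonglongrightarrow> l"
  proof (rule prod_one_minus_limit[of "\<lambda>i. p ^ Suc i"])
    show "summable (\<lambda>i. norm (p ^ Suc i))"
      using p by (subst summable_Suc_iff) (simp add: norm_power summable_geometric)
  qed (use p one_minus_power_nonzero in \<open>auto simp: qpoch_def [abs_def]\<close>)
  obtain K1 where K1: "\<And>n. norm (qpoch p n) \<le> K1"
    using l(2) by (metis BseqE convergentI convergent_imp_Bseq)
  obtain K2 where K2: "\<And>n. norm (inverse (qpoch p n)) \<le> K2"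
    using tendsto_inverse[OF l(2,1)] by (metis BseqE convergentI convergent_imp_Bseq)
  have K: "K1 \<ge> 0" "K2 \<ge> 0"
    using K1[of 0] K2[of 0] norm_ge_zero order_trans by blast+
  \<comment> \<open>Gaussian binomials of order \<open>2 * n\<close>, recentred and extended by 0,
    so that the index set of the sum does not depend on \<open>n\<close>.\<close>
  define B where "B = (\<lambda>n k. if \<bar>k\<bar> \<le> int n then qbinom p (2 * n) (nat (int n + k)) else 0)"
  have B_eq: "B n k = qpoch p (2 * n) * inverse (qpoch p (nat (int n + k))) * inverse (qpoch p (nat (int n - k)))"
    if "\<bar>k\<bar> \<le> int n" for n k
  proof -
    have "nat (int n + k) \<le> 2 * n" "2 * n - nat (int n + k) = nat (int n - k)" using that by auto
    thus ?thesis using that by (simp add: B_def qbinom_def divide_inverse)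
  qed
  have B_bd: "norm (B n k) \<le> K1 * K2 * K2" for n k
  proof (cases "\<bar>k\<bar> \<le> int n")
    case True
    show ?thesis unfolding B_eq[OF True] norm_mult
      using K K1 K2 by (intro mult_mono mult_nonneg_nonneg) auto
  next
    case False
    thus ?thesis using K by (simp add: B_def)
  qed
  have B_lim: "(\<lambda>n. B n k) \<longlonglongrightarrow> l * inverse l * inverse l" for k
  proof (rule Lim_transform_eventually)
    have lims: "filterlim (\<lambda>n::nat. 2 * n) at_top at_top"
      "filterlim (\<lambda>n::nat. nat (int n + k)) at_top at_top"
      "filterlim (\<lambda>n::nat. nat (int n - k)) at_top at_top" by real_asymp+
    show "(\<lambda>n. qpoch p (2 * n) * inverse (qpoch p (nat (int n + k))) * inverse (qpoch p (nat (int n - k))))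
        \<longlonglongrightarrow> l * inverse l * inverse l"
      by (intro tendsto_mult tendsto_inverse l filterlim_compose[OF l(2)] lims)
    show "eventually (\<lambda>n. qpoch p (2 * n) * inverse (qpoch p (nat (int n + k))) * inverse (qpoch p (nat (int n - k))) = B n k) sequentially"
      using eventually_ge_at_top[of "nat \<bar>k\<bar>"] by eventually_elim (subst B_eq, auto)
  qed
  have sum_eq: "(\<Prod>i<n. (1 - w * p ^ i) * (1 - p ^ Suc i / w)) =
      (\<Sum>\<^sub>\<infinity>k. B n k * (jacobi_coeff p k * w powi k))" if w: "w \<noteq> 0" for w n
  proof -
    have "(\<Sum>\<^sub>\<infinity>k. B n k * (jacobi_coeff p k * w powi k)) =
        (\<Sum>\<^sub>\<infinity>k\<in>{- int n..int n}. B n k * (jacobi_coeff p k * w powi k))"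
      by (intro infsum_cong_neutral) (auto simp: B_def)
    also have "\<dots> = (\<Sum>k\<in>{- int n..int n}. B n k * (jacobi_coeff p k * w powi k))"
      by simp
    also have "\<dots> = (\<Sum>k\<le>2 * n. qbinom p (2 * n) k * (jacobi_coeff p (int k - int n) * w powi (int k - int n)))"
      by (rule sum.reindex_bij_witness[of _ "\<lambda>k. int k - int n" "\<lambda>k. nat (int n + k)"])
         (auto simp: B_def)
    also have "\<dots> = (\<Prod>i<n. (1 - w * p ^ i) * (1 - p ^ Suc i / w))"
      by (rule finite_jacobi_triple_product [symmetric]) (use p w in auto)
    finally show ?thesis by simp
  qed
  have L: "ln (norm q) / 2 > 0" using q by (simp add: ln_gt_zero)
  have lim: "(\<lambda>n. \<Sum>\<^sub>\<infinity>k. B n k * (jacobi_coeff p k * w powi k)) \<longlonglongrightarrow>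
      (\<Sum>\<^sub>\<infinity>k. l * inverse l * inverse l * (jacobi_coeff p k * w powi k))"
    if w: "w \<noteq> 0" for w
  proof (rule infsum_dominated_convergence)
    show "(\<lambda>k. K1 * K2 * K2 * norm (jacobi_coeff p k * w powi k)) summable_on UNIV"
      unfolding p_def using jacobi_coeff_norm[OF q]
      by (intro summable_on_cmult_right laurent_weight_bound(1)[OF L w, where K = 1 and b = "ln (norm q) / 2"]) simp
    show "norm (B n k * (jacobi_coeff p k * w powi k)) \<le> K1 * K2 * K2 * norm (jacobi_coeff p k * w powi k)" for n k
      unfolding norm_mult[of "B n k"] by (intro mult_right_mono B_bd) simp
  qed (intro tendsto_mult B_lim tendsto_const)
  hence "(\<lambda>n. \<Prod>i<n. (1 - w * p ^ i) * (1 - p ^ Suc i / w)) \<longlonglongrightarrow>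
      inverse l * (\<Sum>\<^sub>\<infinity>k. jacobi_coeff p k * w powi k)" if "w \<noteq> 0" for w
    using l(1) lim[OF that] unfolding sum_eq[OF that] by (simp add: infsum_cmult_right' mult.assoc)
  thus ?thesis
    using that[of "inverse l"] l(1) by (simp add: p_def)
qed

text \<open>All finite products are bounded below by one multiple of \<open>norm (1 - w)\<close>,
  and this passes to the limit. The annulus has radii with quotient \<open>norm q\<close>, as
  propagation by the functional equation requires, and 1 is the only power of \<open>q\<close> in
  it.\<close>

lemma jacobi_theta_lower_bound:
  assumes q: "norm q > 1"
  obtains \<delta> where "\<delta> > 0"
    "\<And>w. 1 / sqrt (norm q) \<le> norm w \<Longrightarrow> norm w \<le> sqrt (norm q) \<Longrightarrow>
      \<delta> * norm (1 - w) \<le> norm (\<Sum>\<^sub>\<infinity>k. jacobi_coeff (1 / q) k * w powi k)"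
proof -
  define Q where "Q = norm q"
  have Q: "Q > 1" using q by (simp add: Q_def)
  define s where "s = 1 / sqrt Q"
  have s: "0 < s" "s < 1" using Q by (auto simp: s_def)
  \<comment> \<open>\<open>x i\<close> is |q| to the power -1/2 - i, the common bound on this
    annulus for the norms of \<open>w * (1 / q) ^ Suc i\<close> and
    \<open>(1 / q) ^ Suc i / w\<close>.\<close>
  define x where "x = (\<lambda>i. s * (1 / Q) ^ i)"
  have x: "0 \<le> x i" "x i < 1" for i
  proof -
    have "(1 / Q) ^ i \<le> 1" using Q by (intro power_le_one) auto
    hence "x i \<le> s" using s by (simp add: x_def)
    thus "x i < 1" using s by simp
    show "0 \<le> x i" using s Q by (simp add: x_def)
  qed
  define P where "P = (\<lambda>n. \<Prod>i<n. 1 - x i)"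
  have P_pos: "P n > 0" for n
    unfolding P_def using x by (intro prod_pos) auto
  \<comment> \<open>The products \<open>P n\<close> are positive with nonzero limit, so their
    inverses have a bound \<open>K\<close>, and \<open>1 / K\<close> serves as
    \<open>\<kappa>\<close>.\<close>
  obtain \<kappa> where \<kappa>: "\<kappa> > 0" "\<And>n. \<kappa> \<le> P n"
  proof -
    obtain l where l: "l \<noteq> 0" "P \<longlonglongrightarrow> l"
    proof (rule prod_one_minus_limit[of x])
      show "summable (\<lambda>i. norm (x i))"
        using x Q by (auto simp: x_def intro!: summable_mult summable_geometric)
    qed (use x in \<open>auto simp: P_def [abs_def] less_le\<close>)
    then obtain K where K: "K > 0" "\<And>n. norm (inverse (P n)) \<le> K"
      using tendsto_inverse[OF l(2,1)] by (metis BseqE convergentI convergent_imp_Bseq)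
    have "1 / K \<le> P n" for n
      using K(1) K(2)[of n] P_pos[of n] by (simp add: field_simps abs_of_pos)
    thus ?thesis using K that[of "1 / K"] by auto
  qed
  have sq: "sqrt Q * sqrt Q = Q" using Q by simp
  \<comment> \<open>On this annulus \<open>1 - w\<close> is the only factor that is not bounded away from \<open>0\<close>.\<close>
  have main: "\<kappa> * \<kappa> * norm (1 - w) \<le> norm (\<Prod>i<Suc n. (1 - w * (1 / q) ^ i) * (1 - (1 / q) ^ Suc i / w))"
    if w: "1 / sqrt Q \<le> norm w" "norm w \<le> sqrt Q" for w n
  proof -
    have w0: "norm w > 0" using w(1) Q by (smt (verit) divide_pos_pos real_sqrt_gt_zero)
    have le1: "x i \<ge> norm (w * (1 / q) ^ Suc i)" for i
    proof -
      have "norm (w * (1 / q) ^ Suc i) \<le> sqrt Q * (1 / Q) ^ Suc i"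
      proof -
        have "norm (w * (1 / q) ^ Suc i) = norm w * (1 / Q) ^ Suc i"
          by (simp add: norm_mult norm_power norm_divide Q_def)
        moreover have "0 \<le> (1 / Q) ^ Suc i" using Q by auto
        ultimately show ?thesis using mult_right_mono[OF w(2)] by (simp only:)
      qed
      also have "\<dots> = x i"
        using sq Q by (simp add: x_def s_def field_simps)
      finally show ?thesis .
    qed
    have le2: "x i \<ge> norm ((1 / q) ^ Suc i / w)" for i
    proof -
      have "norm ((1 / q) ^ Suc i / w) = (1 / Q) ^ Suc i / norm w"
        by (simp add: norm_power norm_divide norm_mult Q_def)
      also have "\<dots> \<le> (1 / Q) ^ Suc i / (1 / sqrt Q)"
        using w Q w0 by (intro divide_left_mono mult_pos_pos) auto
      also have "\<dots> = x i"
        using sq Q by (simp add: x_def s_def field_simps)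
      finally show ?thesis .
    qed
    have ge: "1 - x i \<le> norm (1 - y)" if "norm y \<le> x i" for i and y :: complex
      using norm_triangle_ineq2[of 1 y] that by simp
    have 1: "\<kappa> \<le> norm (\<Prod>i<n. 1 - w * (1 / q) ^ Suc i)" for n
      unfolding prod_norm[symmetric] using x le1
      by (intro order_trans[OF \<kappa>(2)[of n, unfolded P_def]] prod_mono conjI ge) (auto simp: less_imp_le)
    have 2: "\<kappa> \<le> norm (\<Prod>i<n. 1 - (1 / q) ^ Suc i / w)" for n
      unfolding prod_norm[symmetric] using x le2
      by (intro order_trans[OF \<kappa>(2)[of n, unfolded P_def]] prod_mono conjI ge) (auto simp: less_imp_le)
    \<comment> \<open>The factor \<open>1 - w\<close> is the one with \<open>i = 0\<close> in the
      first family; splitting it off leaves \<open>n\<close> factors there and \<open>Suc n\<close>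
      in the second family.\<close>
    have "norm (\<Prod>i<Suc n. (1 - w * (1 / q) ^ i) * (1 - (1 / q) ^ Suc i / w)) =
        norm (1 - w) * norm (\<Prod>i<n. 1 - w * (1 / q) ^ Suc i) * norm (\<Prod>i<Suc n. 1 - (1 / q) ^ Suc i / w)"
      unfolding prod.distrib norm_mult prod.lessThan_Suc_shift[of "\<lambda>i. 1 - w * (1 / q) ^ i"] by simp
    also have "\<dots> \<ge> norm (1 - w) * \<kappa> * \<kappa>"
      using 1[of n] 2[of "Suc n"] \<kappa>(1) by (intro mult_mono) auto
    finally show ?thesis by (simp add: mult_ac)
  qed
  obtain l where l: "l \<noteq> 0" "\<And>w. w \<noteq> 0 \<Longrightarrow>
      (\<lambda>n. \<Prod>i<n. (1 - w * (1 / q) ^ i) * (1 - (1 / q) ^ Suc i / w)) \<longlonglongrightarrow>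
      l * (\<Sum>\<^sub>\<infinity>k. jacobi_coeff (1 / q) k * w powi k)"
    using jacobi_theta_limit[OF q] by blast
  show ?thesis
  proof (rule that[of "\<kappa> * \<kappa> / norm l"])
    fix w :: complex
    assume w: "1 / sqrt (norm q) \<le> norm w" "norm w \<le> sqrt (norm q)"
    have "0 < 1 / sqrt (norm q)" using Q by (auto simp: Q_def)
    with w have "w \<noteq> 0" by auto
    from tendsto_norm[OF LIMSEQ_Suc[OF l(2)[OF this]]]
    have "\<kappa> * \<kappa> * norm (1 - w) \<le> norm (l * (\<Sum>\<^sub>\<infinity>k. jacobi_coeff (1 / q) k * w powi k))"
      by (rule tendsto_lowerbound) (use main w in \<open>auto simp: Q_def simp del: prod.lessThan_Suc\<close>)
    thus "\<kappa> * \<kappa> / norm l * norm (1 - w) \<le> norm (\<Sum>\<^sub>\<infinity>k. jacobi_coeff (1 / q) k * w powi k)"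
      using l(1) by (simp add: norm_mult field_simps)
  qed (use \<kappa> l in auto)
qed

section \<open>Theta functions of divisors\<close>

lemma q_class_mult:
  assumes "q \<noteq> 0"
  shows "(\<lambda>\<xi>. q * \<xi>) ` q_class q l = q_class q l"
proof -
  have "q * (l * q powi k) = l * q powi (k + 1)" for k
    using assms by (simp add: power_int_add)
  moreover have "l * q powi k = q * (l * q powi (k - 1))" for k
    using assms by (simp add: power_int_diff)
  ultimately show ?thesis unfolding q_class_def by blast
qed

lemma dq_class_bdd_below: "bdd_below ((\<lambda>\<xi>. norm (1 - z / \<xi>)) ` L)"
  by (rule bdd_belowI2[of _ 0]) simp

lemma q_class_nonempty [simp]: "q_class q l \<noteq> {}"
  by (auto simp: q_class_def)

lemma dq_class_le: "\<xi> \<in> L \<Longrightarrow> dq_class z L \<le> norm (1 - z / \<xi>)"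
  unfolding dq_class_def by (rule cINF_lower[OF dq_class_bdd_below])

lemma dq_class_nonneg: "dq_class z (q_class q l) \<ge> 0"
  unfolding dq_class_def by (rule cINF_greatest) auto

text \<open>Multiplication by \<open>q\<close> permutes the class, so the infimum may be taken over
  \<open>q * \<xi>\<close>, and \<open>q\<close> cancels in the quotient.\<close>

lemma dq_class_mult_q:
  assumes "q \<noteq> 0"
  shows "dq_class (q * z) (q_class q l) = dq_class z (q_class q l)"
proof -
  have "dq_class (q * z) (q_class q l) = (INF \<xi>\<in>(\<lambda>\<xi>. q * \<xi>) ` q_class q l. norm (1 - q * z / \<xi>))"
    by (simp add: dq_class_def q_class_mult[OF assms])
  also have "\<dots> = dq_class z (q_class q l)"
    unfolding dq_class_def image_image using assms by simp
  finally show ?thesis .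
qed

lemma dq_class_scale:
  assumes "l \<noteq> 0"
  shows "dq_class z (q_class q l) = dq_class (z / l) (q_class q 1)"
proof -
  have "q_class q l = (\<lambda>\<xi>. l * \<xi>) ` q_class q 1" by (auto simp: q_class_def)
  thus ?thesis using assms by (simp add: dq_class_def image_image)
qed

text \<open>Only finitely many points of the class are comparable in size to \<open>z\<close>; all
  others contribute at least 1/2. So the infimum is bounded below by a minimum of finitely many
  positive numbers.\<close>

lemma dq_class_pos:
  assumes q: "norm q > 1" and l: "l \<noteq> 0" and z: "z \<notin> q_class q l"
  shows "dq_class z (q_class q l) > 0"
proof (cases "z = 0")
  case True
  thus ?thesis by (simp add: dq_class_def)
next
  case z0: False
  define Q where "Q = norm q"
  have Q: "Q > 1" using q by (simp add: Q_def)
  have q0: "q \<noteq> 0" using q by auto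
  define f where "f = (\<lambda>k::int. norm (1 - z / (l * q powi k)))"
  define r where "r = norm (z / l)"
  have r: "r > 0" using z0 l by (simp add: r_def)
  \<comment> \<open>Exactly the exponents for which \<open>z / (l * q powi k)\<close> has norm
    strictly between 1/2 and 2.\<close>
  define A where "A = {k::int. \<bar>of_int k - log Q r\<bar> < log Q 2}"
  have "A \<subseteq> {\<lfloor>log Q r - log Q 2\<rfloor>..\<lceil>log Q r + log Q 2\<rceil>}"
    unfolding A_def by (auto simp: floor_le_iff le_ceiling_iff)
  hence fin: "finite A" by (rule finite_subset) simp
  have pos: "f k > 0" for k
  proof -
    have "z \<noteq> l * q powi k" using z by (auto simp: q_class_def)
    thus ?thesis using l q0 by (simp add: f_def field_simps)
  qed
  define m where "m = Min (insert (1/2) (f ` A))"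
  have m: "m > 0" unfolding m_def using fin pos by (subst Min_gr_iff) auto
  have "m \<le> f k" for k
  proof (cases "k \<in> A")
    case True
    thus ?thesis unfolding m_def using fin by (intro Min_le) auto
  next
    case False
    define y where "y = norm (z / (l * q powi k))"
    have "y = r / Q powi k" by (simp add: y_def r_def Q_def norm_divide norm_mult norm_power_int)
    hence y: "y = Q powr (log Q r - of_int k)"
      using Q r by (simp add: powr_diff powr_real_of_int')
    have "log Q r - of_int k \<ge> log Q 2 \<or> log Q r - of_int k \<le> - log Q 2"
      using False unfolding A_def by auto
    moreover have "y \<ge> 2" if "log Q r - of_int k \<ge> log Q 2"
      using powr_mono[OF that, of Q] Q by (simp add: y)
    moreover have "y \<le> 1 / 2" if "log Q r - of_int k \<le> - log Q 2"
      using powr_mono[OF that, of Q] Q by (simp add: y powr_minus_divide)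
    ultimately have "y \<ge> 2 \<or> y \<le> 1 / 2" by blast
    moreover have "f k \<ge> 1 - y" "f k \<ge> y - 1"
      unfolding f_def y_def using norm_triangle_ineq2[of 1 "z / (l * q powi k)"]
        norm_triangle_ineq2[of "z / (l * q powi k)" 1] by (auto simp: norm_minus_commute)
    ultimately have "f k \<ge> 1 / 2" by linarith
    moreover have "m \<le> 1 / 2" unfolding m_def using fin by (intro Min_le) auto
    ultimately show ?thesis by linarith
  qed
  hence "m \<le> dq_class z (q_class q l)"
    unfolding dq_class_def by (intro cINF_greatest) (auto simp: q_class_def f_def)
  with m show ?thesis by linarith
qed

lemma dq_empty [simp]: "dq z {#} = 1"
  by (simp add: dq_def)

text \<open>Written as a product over the multiset, multiplicities become repeated factors; this
  opens the way to induction on the divisor.\<close>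

lemma dq_add_mset: "dq z (add_mset L \<Lambda>) = dq_class z L * dq z \<Lambda>"
proof -
  have "dq z \<Lambda> = prod_mset (image_mset (dq_class z) \<Lambda>)" for \<Lambda>
    by (simp add: dq_def image_prod_mset_multiplicity)
  thus ?thesis by simp
qed

lemma q_divisor_add_mset:
  "q_divisor q (add_mset L \<Lambda>) \<longleftrightarrow> (\<exists>l. l \<noteq> 0 \<and> L = q_class q l) \<and> q_divisor q \<Lambda>"
  by (auto simp: q_divisor_def)

lemma dq_nonneg:
  assumes "q_divisor q \<Lambda>"
  shows "dq z \<Lambda> \<ge> 0"
  using assms by (induction \<Lambda>) (auto simp: dq_add_mset q_divisor_add_mset dq_class_nonneg)

lemma dq_mult_q:
  assumes "q_divisor q \<Lambda>" "q \<noteq> 0"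
  shows "dq (q * z) \<Lambda> = dq z \<Lambda>"
  using assms by (induction \<Lambda>) (auto simp: dq_add_mset q_divisor_add_mset dq_class_mult_q)

lemma dq_div_power_q:
  assumes "q_divisor q \<Lambda>" "q \<noteq> 0"
  shows "dq (z / q ^ n) \<Lambda> = dq z \<Lambda>"
proof (induction n)
  case (Suc n)
  thus ?case using dq_mult_q[OF assms, of "z / q ^ Suc n"] assms(2) by simp
qed simp

lemma dq_pos:
  assumes "norm q > 1" "q_divisor q \<Lambda>" "z \<notin> \<Union>(set_mset \<Lambda>)"
  shows "dq z \<Lambda> > 0"
  using assms(2,3) by (induction \<Lambda>) (auto simp: dq_add_mset q_divisor_add_mset intro!: mult_pos_pos dq_class_pos assms(1))

text \<open>Finitely many classes cover only a countable set, and the plane is uncountable.\<close>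

lemma exists_dq_pos:
  assumes q: "norm q > 1" and \<Lambda>: "q_divisor q \<Lambda>"
  obtains z where "z \<noteq> 0" "dq z \<Lambda> > 0"
proof -
  have "countable (\<Union>L\<in>set_mset \<Lambda>. L)"
  proof (rule countable_UN)
    fix L assume "L \<in> set_mset \<Lambda>"
    then obtain l where "L = q_class q l" using \<Lambda> by (auto simp: q_divisor_def)
    moreover have "q_class q l = range (\<lambda>k. l * q powi k)" by (auto simp: q_class_def)
    ultimately show "countable L" by simp
  qed (simp add: countable_finite)
  hence "countable (insert 0 (\<Union>(set_mset \<Lambda>)))" by simp
  moreover have "uncountable (UNIV :: complex set)" by (rule uncountable_UNIV_complex)
  ultimately obtain z where "z \<notin> insert 0 (\<Union>(set_mset \<Lambda>))"
    by (metis UNIV_eq_I)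
  thus ?thesis using that dq_pos[OF q \<Lambda>, of z] by auto
qed

section \<open>Theta functions with prescribed zeros\<close>

text \<open>The Cauchy product of bilateral series: the products \<open>a j * b k\<close> form an
  absolutely summable family over pairs, which may be summed along the diagonals via the bijection
  \<open>h\<close>.\<close>

lemma convolution_int:
  fixes a b :: "int \<Rightarrow> complex"
  assumes a: "(\<lambda>k. norm (a k)) summable_on UNIV" and b: "(\<lambda>k. norm (b k)) summable_on UNIV"
  shows "(\<lambda>n. norm (\<Sum>\<^sub>\<infinity>j. a j * b (n - j))) summable_on UNIV"
    and "(\<Sum>\<^sub>\<infinity>n. \<Sum>\<^sub>\<infinity>j. a j * b (n - j)) = (\<Sum>\<^sub>\<infinity>j. a j) * (\<Sum>\<^sub>\<infinity>k. b k)"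
proof -
  define f where "f = (\<lambda>(j, k). a j * b k)"
  have f: "(\<lambda>x. norm (f x)) summable_on UNIV \<times> UNIV"
  proof (rule summable_on_SigmaI)
    show "((\<lambda>k. norm (f (j, k))) has_sum (norm (a j) * (\<Sum>\<^sub>\<infinity>k. norm (b k)))) UNIV" for j
      unfolding f_def prod.case norm_mult using b by (intro has_sum_cmult_right has_sum_infsum)
    show "(\<lambda>j. norm (a j) * (\<Sum>\<^sub>\<infinity>k. norm (b k))) summable_on UNIV"
      using a by (rule summable_on_cmult_left)
  qed auto
  define h :: "int \<times> int \<Rightarrow> int \<times> int" where "h = (\<lambda>(n, j). (j, n - j))"
  have h: "bij h"
    by (rule bij_betw_byWitness[of _ "\<lambda>(j, k). (j + k, j)"]) (auto simp: h_def)
  have fh: "(\<lambda>x. norm ((f \<circ> h) x)) summable_on UNIV \<times> UNIV"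
    using f summable_on_reindex_bij_betw[OF h, of "\<lambda>x. norm (f x)"] by simp
  have fh': "(\<lambda>(n, j). a j * b (n - j)) = f \<circ> h" by (auto simp: f_def h_def fun_eq_iff)
  have sf: "f summable_on UNIV \<times> UNIV" "f \<circ> h summable_on UNIV \<times> UNIV"
    using f fh by (auto intro: abs_summable_summable)
  have "(\<Sum>\<^sub>\<infinity>n. \<Sum>\<^sub>\<infinity>j. a j * b (n - j)) = (\<Sum>\<^sub>\<infinity>x\<in>UNIV \<times> UNIV. (f \<circ> h) x)"
    using sf(2) unfolding fh'[symmetric] by (rule infsum_Sigma'_banach)
  also have "\<dots> = (\<Sum>\<^sub>\<infinity>x\<in>UNIV \<times> UNIV. f x)"
    using infsum_reindex_bij_betw[OF h, of f] by simp
  also have "\<dots> = (\<Sum>\<^sub>\<infinity>j. \<Sum>\<^sub>\<infinity>k. a j * b k)"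
    using sf(1) unfolding f_def by (rule infsum_Sigma'_banach [symmetric])
  also have "\<dots> = (\<Sum>\<^sub>\<infinity>j. a j) * (\<Sum>\<^sub>\<infinity>k. b k)"
    by (simp add: infsum_cmult_right' infsum_cmult_left')
  finally show "(\<Sum>\<^sub>\<infinity>n. \<Sum>\<^sub>\<infinity>j. a j * b (n - j)) = (\<Sum>\<^sub>\<infinity>j. a j) * (\<Sum>\<^sub>\<infinity>k. b k)" .
  have inner: "(\<lambda>j. norm ((f \<circ> h) (n, j))) summable_on UNIV" for n
    using summable_on_SigmaD1[of "\<lambda>n j. norm ((f \<circ> h) (n, j))" UNIV "\<lambda>_. UNIV"] fh
    by (simp add: case_prod_unfold)
  have "(\<lambda>n. \<Sum>\<^sub>\<infinity>j. norm ((f \<circ> h) (n, j))) summable_on UNIV"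
    using summable_on_Sigma_banach[of "\<lambda>n j. norm ((f \<circ> h) (n, j))" UNIV "\<lambda>_. UNIV"] fh
    by (simp add: case_prod_unfold)
  thus "(\<lambda>n. norm (\<Sum>\<^sub>\<infinity>j. a j * b (n - j))) summable_on UNIV"
  proof (rule summable_on_comparison_test)
    fix n
    show "norm (\<Sum>\<^sub>\<infinity>j. a j * b (n - j)) \<le> (\<Sum>\<^sub>\<infinity>j. norm ((f \<circ> h) (n, j)))"
      using norm_infsum_bound[OF inner[of n]] by (simp add: f_def h_def)
  qed simp
qed

text \<open>Jacobi's series at base \<open>1 / q\<close> settles the class of 1, and the
  substitution of \<open>z / l\<close> for \<open>z\<close> moves its zeros to the class of
  \<open>l\<close>.\<close>

lemma class_theta:
  assumes q: "norm q > 1" and l: "l \<noteq> 0"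
  shows "\<exists>c t \<delta>. c \<noteq> 0 \<and> (\<forall>k. q powi k * t k = c * t (k - 1)) \<and>
    (\<forall>z. z \<noteq> 0 \<longrightarrow> (\<lambda>k. norm (t k * z powi k)) summable_on UNIV) \<and> \<delta> > 0 \<and>
    (\<forall>z. z \<noteq> 0 \<longrightarrow> \<delta> * dq_class z (q_class q l) \<le> norm (\<Sum>\<^sub>\<infinity>k. t k * z powi k))"
proof -
  define L where "L = ln (norm q) / 2"
  have L: "L > 0" using q by (simp add: L_def ln_gt_zero)
  have q0: "q \<noteq> 0" using q by auto
  define s where "s = jacobi_coeff (1 / q)"
  have s_norm: "norm (s k) = theta_weight L L k" for k
    unfolding s_def L_def by (rule jacobi_coeff_norm[OF q])
  have s_sm: "(\<lambda>k. norm (s k * z powi k)) summable_on UNIV" if "z \<noteq> 0" for z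
    by (rule laurent_weight_bound(1)[OF L that, where K = 1 and b = L]) (simp add: s_norm)
  interpret theta_recurrence q "- q" 1 s L L
    by unfold_locales (use q q0 jacobi_coeff_recurrence[OF q0] in \<open>auto simp: s_def L_def\<close>)
  obtain \<delta> where \<delta>: "\<delta> > 0" "\<And>w. 1 / sqrt (norm q) \<le> norm w \<Longrightarrow> norm w \<le> sqrt (norm q) \<Longrightarrow>
      \<delta> * norm (1 - w) \<le> norm (\<Sum>\<^sub>\<infinity>k. s k * w powi k)"
    unfolding s_def using jacobi_theta_lower_bound[OF q] by blast
  have sq: "norm q * (1 / sqrt (norm q)) = sqrt (norm q)" using q by (simp add: real_div_sqrt)
  obtain \<delta>' where \<delta>': "\<delta>' > 0" "\<And>z. z \<noteq> 0 \<Longrightarrow>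
      \<delta>' * dq_class z (q_class q 1) * Theta L L (norm z) \<le> norm (\<Sum>\<^sub>\<infinity>k. s k * z powi k)"
  proof -
    \<comment> \<open>The annulus estimate involves the distance to the single point 1, which
      dominates the infimum over its class.\<close>
    have "1 \<in> q_class q 1" unfolding q_class_def by (auto intro: exI[of _ "0::int"])
    hence dle: "dq_class z (q_class q 1) \<le> norm (1 - z)" for z :: complex
      using dq_class_le[of 1 "q_class q 1" z] by simp
    have "\<exists>\<delta>'>0. \<forall>z. z \<noteq> 0 \<longrightarrow> \<delta>' * dq_class z (q_class q 1) * Theta L L (norm z)
        \<le> norm (\<Sum>\<^sub>\<infinity>k. s k * z powi k)"
    proof (rule lower_bound_from_annulus[OF _ _ _ \<delta>(1)])
      show "0 < 1 / sqrt (norm q)" using q by auto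
      fix z :: complex assume "1 / sqrt (norm q) \<le> norm z" "norm z \<le> norm q * (1 / sqrt (norm q))"
      hence "\<delta> * norm (1 - z) \<le> norm (\<Sum>\<^sub>\<infinity>k. s k * z powi k)"
        unfolding sq by (rule \<delta>(2))
      thus "\<delta> * dq_class z (q_class q 1) \<le> norm (\<Sum>\<^sub>\<infinity>k. s k * z powi k)"
        using mult_left_mono[OF dle[of z], of \<delta>] \<delta>(1) by linarith
    qed (use q0 dq_class_mult_q dq_class_nonneg in auto)
    thus ?thesis using that by blast
  qed
  show ?thesis
  \<comment> \<open>Substituting \<open>z / l\<close> multiplies the k-th coefficient by
    \<open>(1 / l) powi k\<close>, and hence the recurrence constant \<open>- q\<close> by
    \<open>1 / l\<close>.\<close>
  proof (intro exI[of _ "- q * (1 / l)"] exI[of _ "\<lambda>k. s k * (1 / l) powi k"] exI[of _ \<delta>'] conjI allI impI)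
    have eq: "s k * (1 / l) powi k * z powi k = s k * (z / l) powi k" for z k
      using l by (simp add: power_int_divide_distrib)
    show "- q * (1 / l) \<noteq> 0" using q0 l by simp
    show "q powi k * (s k * (1 / l) powi k) = - q * (1 / l) * (s (k - 1) * (1 / l) powi (k - 1))" for k
    proof -
      have "(1 / l) powi k = 1 / l * (1 / l) powi (k - 1)" using l by (simp add: power_int_diff)
      moreover have "q powi k * s k = - q * s (k - 1)" using rec[of k] by simp
      ultimately have "(q powi k * s k) * (1 / l) powi k = (- q * s (k - 1)) * (1 / l * (1 / l) powi (k - 1))"
        by (simp only:)
      thus ?thesis by (simp only: mult_ac)
    qed
    fix z :: complex assume z: "z \<noteq> 0"
    show "(\<lambda>k. norm (s k * (1 / l) powi k * z powi k)) summable_on UNIV"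
      unfolding eq using z l by (intro s_sm) auto
    \<comment> \<open>The factor \<open>Theta\<close> is given up here. For the full product it is
      recovered from the functional equation, with the parameters of the total degree.\<close>
    have "\<delta>' * dq_class z (q_class q l) \<le> \<delta>' * dq_class (z / l) (q_class q 1) * Theta L L (norm (z / l))"
      unfolding dq_class_scale[OF l]
      using mult_left_mono[OF Theta_ge_1[OF L, of "norm (z / l)" L], of "\<delta>' * dq_class (z / l) (q_class q 1)"]
        z l \<delta>'(1) dq_class_nonneg[of "z / l" q 1] by simp
    also have "\<dots> \<le> norm (\<Sum>\<^sub>\<infinity>k. s k * (1 / l) powi k * z powi k)"
      unfolding eq using z l by (intro \<delta>'(2)) auto
    finally show "\<delta>' * dq_class z (q_class q l) \<le> norm (\<Sum>\<^sub>\<infinity>k. s k * (1 / l) powi k * z powi k)" .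
  qed (fact \<delta>'(1))
qed

text \<open>Induction on the divisor by multiplying with the theta function of one more class:
  coefficients are convolved, recurrence constants multiplied, shifts added and lower bounds
  multiplied.\<close>

lemma divisor_theta:
  assumes q: "norm q > 1" and \<Lambda>: "q_divisor q \<Lambda>"
  shows "\<exists>c t \<delta>. c \<noteq> 0 \<and> (\<forall>k. q powi k * t k = c * t (k - int (size \<Lambda>))) \<and>
    (\<forall>z. z \<noteq> 0 \<longrightarrow> (\<lambda>k. norm (t k * z powi k)) summable_on UNIV) \<and> \<delta> > 0 \<and>
    (\<forall>z. z \<noteq> 0 \<longrightarrow> \<delta> * dq z \<Lambda> \<le> norm (\<Sum>\<^sub>\<infinity>k. t k * z powi k))"
  using \<Lambda>
proof (induction \<Lambda>)
  case empty
  \<comment> \<open>For the empty divisor the constant function 1 serves, with recurrence constant 1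
    and shift 0.\<close>
  define t :: "int \<Rightarrow> complex" where "t = (\<lambda>k. if k = 0 then 1 else 0)"
  have hs: "((\<lambda>k. t k * z powi k) has_sum 1) UNIV" for z
    by (rule has_sum_finite_neutralI[of "{0}"]) (auto simp: t_def)
  have "(\<lambda>k. norm (t k * z powi k)) summable_on UNIV" for z
    by (rule finite_nonzero_values_imp_summable_on)
       (auto simp: t_def intro: finite_subset[of _ "{0}"])
  moreover have "q powi k * t k = 1 * t (k - int (size {#}))" for k by (simp add: t_def)
  ultimately show ?case
    using infsumI[OF hs] by (intro exI[of _ "1::complex"] exI[of _ t] exI[of _ "1::real"]) simp
next
  case (add L \<Lambda>)
  from add.prems obtain l where l: "l \<noteq> 0" "L = q_class q l" and \<Lambda>: "q_divisor q \<Lambda>"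
    by (auto simp: q_divisor_add_mset)
  have q0: "q \<noteq> 0" using q by auto
  from class_theta[OF q l(1)] obtain c s \<delta> where s: "c \<noteq> 0" "\<And>k. q powi k * s k = c * s (k - 1)"
    "\<And>z. z \<noteq> 0 \<Longrightarrow> (\<lambda>k. norm (s k * z powi k)) summable_on UNIV" "\<delta> > 0"
    "\<And>z. z \<noteq> 0 \<Longrightarrow> \<delta> * dq_class z L \<le> norm (\<Sum>\<^sub>\<infinity>k. s k * z powi k)"
    unfolding l(2) by blast
  from add.IH[OF \<Lambda>] obtain d t \<epsilon> where t: "d \<noteq> 0" "\<And>k. q powi k * t k = d * t (k - int (size \<Lambda>))"
    "\<And>z. z \<noteq> 0 \<Longrightarrow> (\<lambda>k. norm (t k * z powi k)) summable_on UNIV" "\<epsilon> > 0"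
    "\<And>z. z \<noteq> 0 \<Longrightarrow> \<epsilon> * dq z \<Lambda> \<le> norm (\<Sum>\<^sub>\<infinity>k. t k * z powi k)"
    by blast
  define u where "u = (\<lambda>n. \<Sum>\<^sub>\<infinity>j. s j * t (n - j))"
  have u_eq: "u n * z powi n = (\<Sum>\<^sub>\<infinity>j. (s j * z powi j) * (t (n - j) * z powi (n - j)))" if "z \<noteq> 0" for z n
  proof -
    have "s j * t (n - j) * z powi n = (s j * z powi j) * (t (n - j) * z powi (n - j))" for j
    proof -
      have "z powi n = z powi j * z powi (n - j)"
        using that by (simp flip: power_int_add)
      thus ?thesis by (simp only: mult_ac)
    qed
    thus ?thesis unfolding u_def by (subst infsum_cmult_left' [symmetric]) (simp only:)
  qed
  have "q powi n * u n = c * d * u (n - int (size (add_mset L \<Lambda>)))" for n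
  proof -
    \<comment> \<open>Taking \<open>z = q\<close> in \<open>u_eq\<close> distributes
      \<open>q powi n\<close> over the two factors, so both recurrences apply.\<close>
    have "q powi n * u n = (\<Sum>\<^sub>\<infinity>j. (q powi j * s j) * (q powi (n - j) * t (n - j)))"
      using u_eq[OF q0, of n] by (simp add: mult_ac)
    also have "\<dots> = (\<Sum>\<^sub>\<infinity>j. c * d * (s (j - 1) * t ((n - 1 - int (size \<Lambda>)) - (j - 1))))"
    proof (rule infsum_cong)
      fix j
      have "n - j - int (size \<Lambda>) = (n - 1 - int (size \<Lambda>)) - (j - 1)" by simp
      thus "(q powi j * s j) * (q powi (n - j) * t (n - j)) =
          c * d * (s (j - 1) * t ((n - 1 - int (size \<Lambda>)) - (j - 1)))"
        unfolding s(2) t(2) by (simp only: mult_ac)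
    qed
    also have "\<dots> = c * d * (\<Sum>\<^sub>\<infinity>j. s (j - 1) * t ((n - 1 - int (size \<Lambda>)) - (j - 1)))"
      by (rule infsum_cmult_right')
    also have "bij (\<lambda>j::int. j - 1)"
      by (rule bij_betw_byWitness[of _ "\<lambda>k. k + 1"]) auto
    from infsum_reindex_bij_betw[OF this, of "\<lambda>j. s j * t ((n - 1 - int (size \<Lambda>)) - j)"]
    have "(\<Sum>\<^sub>\<infinity>j. s (j - 1) * t ((n - 1 - int (size \<Lambda>)) - (j - 1))) = u (n - 1 - int (size \<Lambda>))"
      by (simp add: u_def)
    finally show ?thesis by (simp add: algebra_simps)
  qed
  moreover have "(\<lambda>n. norm (u n * z powi n)) summable_on UNIV" if "z \<noteq> 0" for z
    unfolding u_eq[OF that] by (rule convolution_int(1)[OF s(3)[OF that] t(3)[OF that]])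
  moreover have "\<delta> * \<epsilon> * dq z (add_mset L \<Lambda>) \<le> norm (\<Sum>\<^sub>\<infinity>n. u n * z powi n)" if "z \<noteq> 0" for z
  proof -
    have "\<delta> * \<epsilon> * dq z (add_mset L \<Lambda>) = (\<delta> * dq_class z L) * (\<epsilon> * dq z \<Lambda>)"
      by (simp add: dq_add_mset)
    also have "\<dots> \<le> norm (\<Sum>\<^sub>\<infinity>k. s k * z powi k) * norm (\<Sum>\<^sub>\<infinity>k. t k * z powi k)"
      using s(4) t(4) dq_nonneg[OF \<Lambda>] by (intro mult_mono s(5) t(5) that) auto
    also have "\<dots> = norm (\<Sum>\<^sub>\<infinity>n. u n * z powi n)"
      unfolding u_eq[OF that] convolution_int(2)[OF s(3)[OF that] t(3)[OF that]] norm_mult ..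
    finally show ?thesis .
  qed
  moreover have "c * d \<noteq> 0" "\<delta> * \<epsilon> > 0" using s t by auto
  ultimately show ?case by blast
qed

section \<open>The truncated product and its remainder\<close>

lemma has_sum_shift_powi:
  fixes t :: "int \<Rightarrow> complex"
  assumes "z \<noteq> 0" and "((\<lambda>k. t k * z powi k) has_sum s) UNIV"
  shows "((\<lambda>k. t (k - int n) * z powi k) has_sum (z ^ n * s)) UNIV"
proof -
  have "bij (\<lambda>k. k - int n)"
    by (rule bij_betw_byWitness[of _ "\<lambda>k. k + int n"]) auto
  from has_sum_reindex_bij_betw[OF this, of "\<lambda>k. t k * z powi k" s] assms(2)
  have "((\<lambda>k. t (k - int n) * z powi (k - int n)) has_sum s) UNIV" by simp
  hence "((\<lambda>k. z ^ n * (t (k - int n) * z powi (k - int n))) has_sum (z ^ n * s)) UNIV"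
    by (rule has_sum_cmult_right)
  moreover have "z ^ n * (t (k - int n) * z powi (k - int n)) = t (k - int n) * z powi k" for k
    using assms(1) by (simp add: power_int_diff)
  ultimately show ?thesis by simp
qed

context theta_recurrence
begin

text \<open>The coefficients of the remainder are estimated in two ranges: for
  \<open>m \<le> - M\<close> they are tails of convergent series, for \<open>m > - M\<close> finite
  sums of \<open>N\<close> terms. Both are dominated by the weights shifted by \<open>N\<close>,
  whose sum cancels against the factor \<open>Theta\<close> in the lower bound.\<close>

lemma truncated_product_quotient:
  fixes a :: "nat \<Rightarrow> complex" and D :: "complex \<Rightarrow> real"
  assumes a: "\<And>n. norm (a n) \<le> K * A ^ n * exp (L * (real n)\<^sup>2)" and K: "K > 0" and A: "A > 0"
    and lower: "\<delta> > 0" "\<And>z. z \<noteq> 0 \<Longrightarrow> \<delta> * D z * Theta b L (norm z) \<le> norm (\<Sum>\<^sub>\<infinity>k. t k * z powi k)"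
  shows "\<exists>f B E. B > 0 \<and> E > 0 \<and> f analytic_on {z. z \<noteq> 0 \<and> D z > 0} \<and>
    (\<forall>z N. z \<noteq> 0 \<longrightarrow> D z > 0 \<longrightarrow>
      norm (f z - (\<Sum>n<N. a n * z ^ n)) \<le> B / D z * E ^ N * exp (L * (real N)\<^sup>2) * norm z ^ N)"
proof -
  obtain K1 where K1: "K1 > 0" "\<And>k. norm (t k) \<le> K1 * theta_weight b L k"
    using coeff_bound by blast
  define w where "w = theta_weight b L"
  define g where "g = (\<lambda>n::nat. exp (L * (real n)\<^sup>2))"
  \<comment> \<open>Chosen so that \<open>E0\<close> is at least \<open>A\<close> while the slope
    contribution \<open>\<alpha>\<close>, the logarithm of \<open>E0\<close> minus \<open>b\<close>,
    is nonnegative.\<close>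
  define \<alpha> where "\<alpha> = \<bar>ln A - b\<bar>"
  define E0 where "E0 = exp (b + \<alpha>)"
  define K2 where "K2 = K * K1"
  have K2: "K2 > 0" using K K1 by (simp add: K2_def)
  have w: "w k > 0" for k by (simp add: w_def theta_weight_pos)
  have g: "g n > 0" for n by (simp add: g_def)
  have "A = exp (ln A)" using A by simp
  also have "\<dots> \<le> E0" unfolding E0_def \<alpha>_def by simp
  finally have AE: "A \<le> E0" .
  \<comment> \<open>The exponents of \<open>g n * w (m - n)\<close> and \<open>g N * w (m - N)\<close> differ by a term linear in \<open>n - N\<close>,
      whose slope \<open>\<alpha> + 2 * L * m\<close> is negative for very negative \<open>m\<close>.\<close>
  have est: "norm (a n * t (m - int n)) \<le> K2 * E0 ^ N * g N * w (m - int N) *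
      exp ((real n - real N) * (\<alpha> + 2 * L * of_int m))" for n N m
  proof -
    have "norm (a n * t (m - int n)) \<le> (K * E0 ^ n * g n) * (K1 * w (m - int n))"
      unfolding norm_mult
    proof (rule mult_mono)
      have "K * A ^ n * g n \<le> K * E0 ^ n * g n"
        using K A AE g[of n] by (intro mult_right_mono mult_left_mono power_mono) auto
      with a[of n] show "norm (a n) \<le> K * E0 ^ n * g n" by (simp add: g_def)
    qed (use K1 K g w in \<open>auto simp: w_def E0_def less_imp_le\<close>)
    also have "\<dots> = K2 * (E0 ^ n * g n * w (m - int n))" by (simp add: K2_def)
    also have "E0 ^ n * g n * w (m - int n) = E0 ^ N * g N * w (m - int N) *
        exp ((real n - real N) * (\<alpha> + 2 * L * of_int m))"
      unfolding E0_def g_def w_def theta_weight_def exp_of_nat_mult [symmetric] exp_add [symmetric]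
      by (rule arg_cong[of _ _ exp]) (simp add: algebra_simps power2_eq_square)
    finally show ?thesis by (simp add: mult_ac)
  qed
  \<comment> \<open>For \<open>m \<le> - M\<close> the slope is at most \<open>- ln 2\<close>, so
    the tail is dominated by a geometric series of ratio 1/2.\<close>
  define M where "M = \<lceil>(\<alpha> + ln 2) / (2 * L)\<rceil>"
  have "(\<alpha> + ln 2) / (2 * L) \<le> of_int M" by (simp add: M_def)
  hence M: "\<alpha> + ln 2 \<le> 2 * L * of_int M" using L_pos by (simp add: field_simps)
  have \<alpha>: "\<alpha> \<ge> 0" by (simp add: \<alpha>_def)
  have LM: "2 * L * of_int M \<ge> 0" using M \<alpha> by (smt (verit) ln_gt_zero)
  \<comment> \<open>\<open>exp (2 * L * of_int M)\<close> absorbs the exponential in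
    \<open>head\<close>, and \<open>exp 1\<close> the number \<open>N\<close> of summands there, as
    \<open>N\<close> is at most \<open>exp 1 ^ N\<close>.\<close>
  define E where "E = E0 * exp (2 * L * of_int M + 1)"
  have E0: "E0 > 0" by (simp add: E0_def)
  have E: "E > 0" by (simp add: E_def E0)
  have E0E: "E0 \<le> E" using LM E0 by (simp add: E_def)
  have tail: "norm (a (n + N) * t (m - int (n + N))) \<le> K2 * E0 ^ N * g N * w (m - int N) * (1 / 2) ^ n"
    if m: "m \<le> - M" for m n N
  proof -
    have "2 * L * of_int m \<le> 2 * L * of_int (- M)"
      using m L_pos by (intro mult_left_mono) (simp_all only: of_int_le_iff)
    hence "\<alpha> + 2 * L * of_int m \<le> ln (1 / 2)" using M by (simp add: ln_div)
    hence "exp (real n * (\<alpha> + 2 * L * of_int m)) \<le> exp (real n * ln (1 / 2))"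
      by (simp add: mult_left_mono)
    also have "\<dots> = (1 / 2) ^ n" by (subst exp_of_nat_mult) simp
    finally have "K2 * E0 ^ N * g N * w (m - int N) * exp (real n * (\<alpha> + 2 * L * of_int m)) \<le>
        K2 * E0 ^ N * g N * w (m - int N) * (1 / 2) ^ n"
      using K2 E0 g[of N] w[of "m - int N"] by (intro mult_left_mono) auto
    with est[of "n + N" m N] show ?thesis by simp
  qed
  have head: "norm (a n * t (m - int n)) \<le> K2 * E0 ^ N * g N * w (m - int N) * exp (2 * L * of_int M) ^ N"
    if m: "m > - M" and n: "n < N" for m n N
  proof -
    have "2 * L * of_int (- M) \<le> 2 * L * of_int m"
      using m L_pos by (intro mult_left_mono) (simp_all only: of_int_le_iff)
    hence "\<alpha> + 2 * L * of_int m \<ge> - (2 * L * of_int M)" using \<alpha> by simp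
    hence "(real n - real N) * (\<alpha> + 2 * L * of_int m) \<le> (real n - real N) * (- (2 * L * of_int M))"
      using n by (intro mult_left_mono_neg) auto
    also have "\<dots> \<le> real N * (2 * L * of_int M)"
      using LM by (simp add: left_diff_distrib)
    finally have "exp ((real n - real N) * (\<alpha> + 2 * L * of_int m)) \<le> exp (2 * L * of_int M) ^ N"
      by (simp flip: exp_of_nat_mult)
    hence "K2 * E0 ^ N * g N * w (m - int N) * exp ((real n - real N) * (\<alpha> + 2 * L * of_int m)) \<le>
        K2 * E0 ^ N * g N * w (m - int N) * exp (2 * L * of_int M) ^ N"
      using K2 E0 g[of N] w[of "m - int N"] by (intro mult_left_mono) auto
    with est[of n m N] show ?thesis by linarith
  qed
  \<comment> \<open>\<open>p\<close> lists the coefficients of the numerator \<open>P\<close>, and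
    \<open>r N\<close> those of \<open>P\<close> minus \<open>T\<close> times the N-th partial
    sum.\<close>
  define p where "p = (\<lambda>m. if m \<le> - M then \<Sum>n. a n * t (m - int n) else 0)"
  define r where "r = (\<lambda>N m. p m - (\<Sum>n<N. a n * t (m - int n)))"
  have r_bound: "norm (r N m) \<le> 2 * K2 * E ^ N * g N * w (m - int N)" for N m
  proof (cases "m \<le> - M")
    case True
    define c' where "c' = K2 * E0 ^ N * g N * w (m - int N)"
    have sm: "summable (\<lambda>n. a n * t (m - int n))"
      by (rule summable_comparison_test'[of "\<lambda>n. K2 * E0 ^ 0 * g 0 * w (m - int 0) * (1 / 2) ^ n" 0])
         (use tail[OF True, of _ 0] in \<open>auto intro!: summable_mult summable_geometric\<close>)
    have "r N m = (\<Sum>n. a (n + N) * t (m - int (n + N)))"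
      using suminf_minus_initial_segment[OF sm, of N] True by (simp add: r_def p_def)
    also have "norm \<dots> \<le> (\<Sum>n. c' * (1 / 2) ^ n)"
      unfolding c'_def using tail[OF True]
      by (intro norm_suminf_le summable_mult summable_geometric) auto
    also have "\<dots> = 2 * c'"
      by (subst suminf_mult) (auto simp: suminf_geometric summable_geometric)
    also have "\<dots> \<le> 2 * (K2 * E ^ N * g N * w (m - int N))"
      unfolding c'_def using K2 E0 E0E g[of N] w[of "m - int N"]
      by (intro mult_left_mono mult_right_mono power_mono) auto
    finally show ?thesis by (simp add: mult.assoc)
  next
    case False
    have "norm (r N m) = norm (\<Sum>n<N. a n * t (m - int n))"
      using False by (simp add: r_def p_def)
    also have "\<dots> \<le> of_nat (card {..<N}) * (K2 * E0 ^ N * g N * w (m - int N) * exp (2 * L * of_int M) ^ N)"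
      using False head by (intro sum_norm_bound) auto
    also have "\<dots> \<le> exp 1 ^ N * (K2 * E0 ^ N * g N * w (m - int N) * exp (2 * L * of_int M) ^ N)"
    proof (rule mult_right_mono)
      have "real N \<le> exp (real N)" using exp_ge_add_one_self[of "real N"] by linarith
      thus "of_nat (card {..<N}) \<le> (exp 1 ^ N :: real)" using exp_of_nat_mult[of N "1::real"] by simp
    qed (use K2 E0 g[of N] w[of "m - int N"] in auto)
    also have "\<dots> = K2 * E ^ N * g N * w (m - int N)"
      unfolding E_def exp_add power_mult_distrib by (simp only: mult_ac)
    also have "\<dots> \<le> 2 * (K2 * E ^ N * g N * w (m - int N))"
      using K2 E g[of N] w[of "m - int N"] by simp
    finally show ?thesis by (simp add: mult.assoc)
  qed
  define T where "T = (\<lambda>z. \<Sum>\<^sub>\<infinity>k. t k * z powi k)"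
  define P where "P = (\<lambda>z. \<Sum>\<^sub>\<infinity>k. p k * z powi k)"
  \<comment> \<open>For \<open>N = 0\<close> nothing is subtracted, so \<open>r 0\<close> is
    \<open>p\<close> itself.\<close>
  have p_bound: "norm (p k) \<le> 2 * K2 * theta_weight b L k" for k
    using r_bound[of 0 k] by (simp add: r_def g_def w_def)
  note t_sm = laurent_weight_bound(1)[OF L_pos _ K1(2)]
  note p_sm = laurent_weight_bound(1)[OF L_pos _ p_bound]
  have T_hol: "T holomorphic_on - {0}"
    unfolding T_def by (intro laurent_holomorphic t_sm)
  have P_hol: "P holomorphic_on - {0}"
    unfolding P_def by (intro laurent_holomorphic p_sm)
  have T_lower: "norm (T z) > 0" if "z \<noteq> 0" "D z > 0" for z
  proof -
    have "0 < \<delta> * D z * Theta b L (norm z)"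
      using lower(1) that Theta_ge_1[OF L_pos, of "norm z" b] by (intro mult_pos_pos) auto
    also have "\<dots> \<le> norm (T z)" using lower(2) that by (simp add: T_def)
    finally show ?thesis .
  qed
  have remainder: "norm (P z - (\<Sum>n<N. a n * z ^ n) * T z) \<le>
      2 * K2 * E ^ N * g N * norm z ^ N * Theta b L (norm z)" if z: "z \<noteq> 0" for z N
  proof -
    have T_sum: "((\<lambda>k. t k * z powi k) has_sum T z) UNIV"
      unfolding T_def using t_sm[OF z] by (rule has_sum_infsum[OF abs_summable_summable])
    have P_sum: "((\<lambda>k. p k * z powi k) has_sum P z) UNIV"
      unfolding P_def using p_sm[OF z] by (rule has_sum_infsum[OF abs_summable_summable])
    have "((\<lambda>m. (\<Sum>n<N. a n * t (m - int n)) * z powi m) has_sum ((\<Sum>n<N. a n * z ^ n) * T z)) UNIV"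
    proof (induction N)
      case (Suc N)
      have "((\<lambda>m. a N * (t (m - int N) * z powi m)) has_sum (a N * (z ^ N * T z))) UNIV"
        by (intro has_sum_cmult_right has_sum_shift_powi z T_sum)
      from has_sum_add[OF Suc this] show ?case by (simp add: algebra_simps)
    qed simp
    from has_sum_add[OF P_sum has_sum_uminusI[OF this]]
    have 1: "((\<lambda>m. r N m * z powi m) has_sum (P z - (\<Sum>n<N. a n * z ^ n) * T z)) UNIV"
      by (simp add: r_def algebra_simps)
    \<comment> \<open>Shifting the index by \<open>N\<close> factors out \<open>z ^ N\<close> and
      turns the bound into one by unshifted weights.\<close>
    define u where "u = (\<lambda>k. r N (k + int N))"
    have u: "norm (u k) \<le> 2 * K2 * E ^ N * g N * theta_weight b L k" for k
      using r_bound[of N "k + int N"] by (simp add: u_def w_def)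
    have "((\<lambda>k. u k * z powi k) has_sum (\<Sum>\<^sub>\<infinity>k. u k * z powi k)) UNIV"
      using laurent_weight_bound(1)[OF L_pos z u] by (rule has_sum_infsum[OF abs_summable_summable])
    from has_sum_shift_powi[OF z this, of N]
    have "((\<lambda>m. r N m * z powi m) has_sum (z ^ N * (\<Sum>\<^sub>\<infinity>k. u k * z powi k))) UNIV"
      by (simp add: u_def)
    from has_sum_unique[OF 1 this]
    have "norm (P z - (\<Sum>n<N. a n * z ^ n) * T z) = norm z ^ N * norm (\<Sum>\<^sub>\<infinity>k. u k * z powi k)"
      by (simp add: norm_mult norm_power)
    also have "\<dots> \<le> norm z ^ N * (2 * K2 * E ^ N * g N * Theta b L (norm z))"
      by (intro mult_left_mono laurent_weight_bound(2)[OF L_pos z u]) auto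
    finally show ?thesis by (simp add: mult_ac)
  qed
  show ?thesis
  proof (rule exI[of _ "\<lambda>z. P z / T z"], rule exI[of _ "2 * K2 / \<delta>"], rule exI[of _ E],
      intro conjI allI impI)
    show "2 * K2 / \<delta> > 0" using K2 lower(1) by simp
    show "E > 0" by (rule E)
    have an: "F analytic_on {z. z \<noteq> 0 \<and> D z > 0}" if "F holomorphic_on - {0}" for F
      by (rule analytic_on_subset[of F "- {0}"]) (use that in \<open>auto simp: analytic_on_open open_Compl\<close>)
    show "(\<lambda>z. P z / T z) analytic_on {z. z \<noteq> 0 \<and> D z > 0}"
    proof (rule analytic_on_divide[OF an[OF P_hol] an[OF T_hol]])
      fix z assume "z \<in> {z. z \<noteq> 0 \<and> D z > 0}"
      thus "T z \<noteq> 0" using T_lower[of z] by simp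
    qed
    fix z N assume z: "z \<noteq> 0" "D z > 0"
    have Tz: "T z \<noteq> 0" using T_lower[OF z] by auto
    have Th: "Theta b L (norm z) > 0" using Theta_ge_1[OF L_pos, of "norm z" b] z by auto
    have "P z / T z - (\<Sum>n<N. a n * z ^ n) = (P z - (\<Sum>n<N. a n * z ^ n) * T z) / T z"
      using Tz by (simp add: field_simps)
    hence "norm (P z / T z - (\<Sum>n<N. a n * z ^ n)) = norm (P z - (\<Sum>n<N. a n * z ^ n) * T z) / norm (T z)"
      by (simp add: norm_divide)
    also have "\<dots> \<le> (2 * K2 * E ^ N * g N * norm z ^ N * Theta b L (norm z)) / (\<delta> * D z * Theta b L (norm z))"
      using remainder[OF z(1)] lower z Th K2 E g[of N]
      by (intro frac_le) (auto simp: T_def)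
    also have "\<dots> = 2 * K2 / \<delta> / D z * E ^ N * exp (L * (real N)\<^sup>2) * norm z ^ N"
      using Th z lower(1) by (simp add: g_def field_simps)
    finally show "norm (P z / T z - (\<Sum>n<N. a n * z ^ n)) \<le> 
      2 * K2 / \<delta> / D z * E ^ N * exp (L * (real N)\<^sup>2) * norm z ^ N" .
  qed
qed

end

section \<open>Germs, expansions and their vector spaces\<close>

lemma q_sector_mono: "\<epsilon>' \<le> \<epsilon> \<Longrightarrow> R \<le> R' \<Longrightarrow> q_sector \<Lambda> \<epsilon> R \<subseteq> q_sector \<Lambda> \<epsilon>' R'"
  by (auto simp: q_sector_def)

lemma q_germ_refl: "f \<in> q_germ \<Lambda> f"
  by (auto simp: q_germ_def intro: exI[of _ "1::real"])

lemma q_germ_sym: "g \<in> q_germ \<Lambda> f \<Longrightarrow> f \<in> q_germ \<Lambda> g"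
  by (auto simp: q_germ_def)

text \<open>Both agreements hold on the smaller of the two radii. The arbitrary \<open>h\<close>
  covers sums and, by ignoring one argument, scalar multiples.\<close>

lemma q_germ_combine:
  assumes "f' \<in> q_germ \<Lambda> f" "g' \<in> q_germ \<Lambda> g"
  shows "(\<lambda>z. h (f' z) (g' z)) \<in> q_germ \<Lambda> (\<lambda>z. h (f z) (g z))"
proof -
  obtain R S where "R > 0" "\<And>z. z \<in> q_sector \<Lambda> 0 R \<Longrightarrow> f' z = f z"
    "S > 0" "\<And>z. z \<in> q_sector \<Lambda> 0 S \<Longrightarrow> g' z = g z"
    using assms by (auto simp: q_germ_def)
  moreover have "q_sector \<Lambda> 0 (min R S) \<subseteq> q_sector \<Lambda> 0 R" "q_sector \<Lambda> 0 (min R S) \<subseteq> q_sector \<Lambda> 0 S"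
    by (rule q_sector_mono; simp)+
  ultimately show ?thesis
    unfolding q_germ_def by (intro CollectI exI[of _ "min R S"]) (auto simp: subset_iff)
qed

lemma q_germ_trans:
  assumes "h \<in> q_germ \<Lambda> g" "g \<in> q_germ \<Lambda> f"
  shows "h \<in> q_germ \<Lambda> f"
proof -
  obtain R S where "R > 0" "\<And>z. z \<in> q_sector \<Lambda> 0 R \<Longrightarrow> h z = g z"
    "S > 0" "\<And>z. z \<in> q_sector \<Lambda> 0 S \<Longrightarrow> g z = f z"
    using assms by (auto simp: q_germ_def)
  moreover have "q_sector \<Lambda> 0 (min R S) \<subseteq> q_sector \<Lambda> 0 R" "q_sector \<Lambda> 0 (min R S) \<subseteq> q_sector \<Lambda> 0 S"
    by (rule q_sector_mono; simp)+
  ultimately show ?thesis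
    unfolding q_germ_def by (intro CollectI exI[of _ "min R S"]) (auto simp: subset_iff)
qed

lemma q_germ_eq: "g \<in> q_germ \<Lambda> f \<Longrightarrow> q_germ \<Lambda> g = q_germ \<Lambda> f"
  using q_germ_sym q_germ_trans by blast

text \<open>All representatives give the same germ, so the union in the definition of the sum is a
  union of equal sets over a nonempty index set.\<close>

lemma A_space_add: "q_germ \<Lambda> f \<oplus>\<^bsub>A_space q \<Lambda>\<^esub> q_germ \<Lambda> g = q_germ \<Lambda> (\<lambda>z. f z + g z)"
proof -
  have "q_germ \<Lambda> (\<lambda>z. f' z + g' z) = q_germ \<Lambda> (\<lambda>z. f z + g z)"
    if "f' \<in> q_germ \<Lambda> f" "g' \<in> q_germ \<Lambda> g" for f' g'
    by (intro q_germ_eq q_germ_combine[OF that])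
  hence "q_germ \<Lambda> f \<oplus>\<^bsub>A_space q \<Lambda>\<^esub> q_germ \<Lambda> g =
      (\<Union>f'\<in>q_germ \<Lambda> f. \<Union>g'\<in>q_germ \<Lambda> g. q_germ \<Lambda> (\<lambda>z. f z + g z))"
    by (simp add: A_space_def)
  moreover have "q_germ \<Lambda> f \<noteq> {}" "q_germ \<Lambda> g \<noteq> {}" using q_germ_refl by blast+
  ultimately show ?thesis by simp
qed

lemma A_space_smult: "c \<odot>\<^bsub>A_space q \<Lambda>\<^esub> q_germ \<Lambda> f = q_germ \<Lambda> (\<lambda>z. c * f z)"
proof -
  have "q_germ \<Lambda> (\<lambda>z. c * f' z) = q_germ \<Lambda> (\<lambda>z. c * f z)" if "f' \<in> q_germ \<Lambda> f" for f'
    by (intro q_germ_eq q_germ_combine[OF that that, where h = "\<lambda>x y. c * x"])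
  hence "c \<odot>\<^bsub>A_space q \<Lambda>\<^esub> q_germ \<Lambda> f = (\<Union>f'\<in>q_germ \<Lambda> f. q_germ \<Lambda> (\<lambda>z. c * f z))"
    by (simp add: A_space_def)
  moreover have "q_germ \<Lambda> f \<noteq> {}" using q_germ_refl by blast
  ultimately show ?thesis by simp
qed

section \<open>Vector space structure on functions with expansions\<close>

lemma B_funs_add:
  assumes "f \<in> B_funs \<Lambda>" "g \<in> B_funs \<Lambda>"
  shows "(\<lambda>z. f z + g z) \<in> B_funs \<Lambda>"
proof -
  obtain R S where R: "R > 0" "f analytic_on q_sector \<Lambda> 0 R"
      "\<And>\<epsilon> r. \<epsilon> > 0 \<Longrightarrow> 0 < r \<Longrightarrow> r < R \<Longrightarrow> bounded (f ` q_sector \<Lambda> \<epsilon> r)"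
    and S: "S > 0" "g analytic_on q_sector \<Lambda> 0 S"
      "\<And>\<epsilon> r. \<epsilon> > 0 \<Longrightarrow> 0 < r \<Longrightarrow> r < S \<Longrightarrow> bounded (g ` q_sector \<Lambda> \<epsilon> r)"
    using assms by (auto simp: B_funs_def)
  have "f analytic_on q_sector \<Lambda> 0 (min R S)" "g analytic_on q_sector \<Lambda> 0 (min R S)"
    by (rule analytic_on_subset[OF R(2)] analytic_on_subset[OF S(2)]; rule q_sector_mono; simp)+
  hence "(\<lambda>z. f z + g z) analytic_on q_sector \<Lambda> 0 (min R S)" by (rule analytic_on_add)
  thus ?thesis
    using R S unfolding B_funs_def
    by (intro CollectI exI[of _ "min R S"]) (auto intro!: bounded_plus_comp)
qed

lemma B_funs_scale:
  assumes "f \<in> B_funs \<Lambda>"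
  shows "(\<lambda>z. c * f z) \<in> B_funs \<Lambda>"
proof -
  obtain R where R: "R > 0" "f analytic_on q_sector \<Lambda> 0 R"
      "\<And>\<epsilon> r. \<epsilon> > 0 \<Longrightarrow> 0 < r \<Longrightarrow> r < R \<Longrightarrow> bounded (f ` q_sector \<Lambda> \<epsilon> r)"
    using assms by (auto simp: B_funs_def)
  have "bounded ((\<lambda>z. c * f z) ` X)" if "bounded (f ` X)" for X
    using bounded_linear_image[OF that bounded_linear_mult_right[of c]] by (simp add: image_image)
  thus ?thesis
    using R unfolding B_funs_def
    by (intro CollectI exI[of _ R]) (auto intro!: analytic_on_mult analytic_on_const)
qed

lemma has_q_expansionE:
  assumes "has_q_expansion q \<Lambda> f a"
  obtains C A R where "C > 0" "A > 0" "R > 0" "\<forall>\<epsilon>>0. \<forall>N::nat. \<forall>z\<in>q_sector \<Lambda> \<epsilon> R.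
      norm (f z - (\<Sum>n<N. fps_nth a n * z ^ n))
          < C / \<epsilon> * A ^ N * norm q powr (real N ^ 2 / (2 * real (size \<Lambda>))) * norm z ^ N"
  using assms unfolding has_q_expansion_def by (elim exE conjE) (rule that)

lemma has_q_expansion_germ:
  assumes f: "has_q_expansion q \<Lambda> f a" and g: "g \<in> q_germ \<Lambda> f"
  shows "has_q_expansion q \<Lambda> g a"
proof -
  obtain C A R where f': "C > 0" "A > 0" "R > 0" "\<forall>\<epsilon>>0. \<forall>N::nat. \<forall>z\<in>q_sector \<Lambda> \<epsilon> R.
      norm (f z - (\<Sum>n<N. fps_nth a n * z ^ n))
          < C / \<epsilon> * A ^ N * norm q powr (real N ^ 2 / (2 * real (size \<Lambda>))) * norm z ^ N"
    by (rule has_q_expansionE[OF f])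
  obtain S where S: "S > 0" "\<And>z. z \<in> q_sector \<Lambda> 0 S \<Longrightarrow> g z = f z"
    using g by (auto simp: q_germ_def)
  show ?thesis unfolding has_q_expansion_def
  proof (intro exI conjI allI impI ballI)
    fix \<epsilon> :: real and N z assume \<epsilon>: "\<epsilon> > 0" and z: "z \<in> q_sector \<Lambda> \<epsilon> (min R S)"
    have "z \<in> q_sector \<Lambda> \<epsilon> R" "z \<in> q_sector \<Lambda> 0 S"
      using z \<epsilon> q_sector_mono[of \<epsilon> \<epsilon> "min R S" R] q_sector_mono[of 0 \<epsilon> "min R S" S] by auto
    thus "norm (g z - (\<Sum>n<N. fps_nth a n * z ^ n))
          < C / \<epsilon> * A ^ N * norm q powr (real N ^ 2 / (2 * real (size \<Lambda>))) * norm z ^ N"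
      using f'(4)[rule_format, OF \<epsilon>] S(2) by simp
  qed (use f' S in auto)
qed

lemma has_q_expansion_add:
  assumes "has_q_expansion q \<Lambda> f a" "has_q_expansion q \<Lambda> g b"
  shows "has_q_expansion q \<Lambda> (\<lambda>z. f z + g z) (a + b)"
proof -
  let ?G = "\<lambda>N. norm q powr (real N ^ 2 / (2 * real (size \<Lambda>)))"
  obtain C A R where f: "C > 0" "A > 0" "R > 0" "\<forall>\<epsilon>>0. \<forall>N::nat. \<forall>z\<in>q_sector \<Lambda> \<epsilon> R.
      norm (f z - (\<Sum>n<N. fps_nth a n * z ^ n)) < C / \<epsilon> * A ^ N * ?G N * norm z ^ N"
    by (rule has_q_expansionE[OF assms(1)])
  obtain D B S where g: "D > 0" "B > 0" "S > 0" "\<forall>\<epsilon>>0. \<forall>N::nat. \<forall>z\<in>q_sector \<Lambda> \<epsilon> S.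
      norm (g z - (\<Sum>n<N. fps_nth b n * z ^ n)) < D / \<epsilon> * B ^ N * ?G N * norm z ^ N"
    by (rule has_q_expansionE[OF assms(2)])
  define E where "E = max A B"
  show ?thesis unfolding has_q_expansion_def
  proof (intro exI conjI allI impI ballI)
    fix \<epsilon> :: real and N z assume \<epsilon>: "\<epsilon> > 0" and z: "z \<in> q_sector \<Lambda> \<epsilon> (min R S)"
    have z': "z \<in> q_sector \<Lambda> \<epsilon> R" "z \<in> q_sector \<Lambda> \<epsilon> S"
      using z q_sector_mono[of \<epsilon> \<epsilon> "min R S" R] q_sector_mono[of \<epsilon> \<epsilon> "min R S" S] by auto
    have "f z + g z - (\<Sum>n<N. fps_nth (a + b) n * z ^ n) =
        (f z - (\<Sum>n<N. fps_nth a n * z ^ n)) + (g z - (\<Sum>n<N. fps_nth b n * z ^ n))"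
      by (simp add: algebra_simps sum.distrib)
    hence "norm (f z + g z - (\<Sum>n<N. fps_nth (a + b) n * z ^ n)) \<le>
        norm (f z - (\<Sum>n<N. fps_nth a n * z ^ n)) + norm (g z - (\<Sum>n<N. fps_nth b n * z ^ n))"
      using norm_triangle_ineq by metis
    also have "\<dots> < C / \<epsilon> * A ^ N * ?G N * norm z ^ N + D / \<epsilon> * B ^ N * ?G N * norm z ^ N"
      using f(4)[rule_format, OF \<epsilon> z'(1)] g(4)[rule_format, OF \<epsilon> z'(2)] by (rule add_strict_mono)
    also have "\<dots> \<le> C / \<epsilon> * E ^ N * ?G N * norm z ^ N + D / \<epsilon> * E ^ N * ?G N * norm z ^ N"
      using f(1,2) g(1,2) \<epsilon>
      by (intro add_mono mult_right_mono mult_left_mono power_mono) (auto simp: E_def)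
    also have "\<dots> = (C + D) / \<epsilon> * E ^ N * ?G N * norm z ^ N"
      by (simp add: add_divide_distrib distrib_right)
    finally show "norm (f z + g z - (\<Sum>n<N. fps_nth (a + b) n * z ^ n)) <
      (C + D) / \<epsilon> * E ^ N * ?G N * norm z ^ N" .
  qed (use f g in \<open>auto simp: E_def\<close>)
qed

lemma has_q_expansion_scale:
  assumes "has_q_expansion q \<Lambda> f a"
  shows "has_q_expansion q \<Lambda> (\<lambda>z. c * f z) (fps_const c * a)"
proof -
  let ?G = "\<lambda>N. norm q powr (real N ^ 2 / (2 * real (size \<Lambda>)))"
  obtain C A R where f: "C > 0" "A > 0" "R > 0" "\<forall>\<epsilon>>0. \<forall>N::nat. \<forall>z\<in>q_sector \<Lambda> \<epsilon> R.
      norm (f z - (\<Sum>n<N. fps_nth a n * z ^ n)) < C / \<epsilon> * A ^ N * ?G N * norm z ^ N"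
    by (rule has_q_expansionE[OF assms(1)])
  show ?thesis unfolding has_q_expansion_def
  proof (intro exI conjI allI impI ballI)
    fix \<epsilon> :: real and N z assume \<epsilon>: "\<epsilon> > 0" and z: "z \<in> q_sector \<Lambda> \<epsilon> R"
    have "c * f z - (\<Sum>n<N. fps_nth (fps_const c * a) n * z ^ n) = c * (f z - (\<Sum>n<N. fps_nth a n * z ^ n))"
      by (simp add: algebra_simps sum_distrib_left)
    \<comment> \<open>The constant is \<open>norm c + 1\<close>, which stays positive for
      \<open>c = 0\<close> and so preserves the strict inequality.\<close>
    hence "norm (c * f z - (\<Sum>n<N. fps_nth (fps_const c * a) n * z ^ n)) \<le>
        (norm c + 1) * norm (f z - (\<Sum>n<N. fps_nth a n * z ^ n))"
      by (simp add: norm_mult distrib_right)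
    also have "\<dots> < (norm c + 1) * (C / \<epsilon> * A ^ N * ?G N * norm z ^ N)"
      using f(4)[rule_format, OF \<epsilon> z] by (intro mult_strict_left_mono) (auto intro: add_nonneg_pos)
    also have "\<dots> = (norm c + 1) * C / \<epsilon> * A ^ N * ?G N * norm z ^ N"
      by simp
    finally show "norm (c * f z - (\<Sum>n<N. fps_nth (fps_const c * a) n * z ^ n)) <
      (norm c + 1) * C / \<epsilon> * A ^ N * ?G N * norm z ^ N" .
  qed (use f in \<open>auto intro!: mult_pos_pos add_nonneg_pos\<close>)
qed

lemma A_funs_add: "f \<in> A_funs q \<Lambda> \<Longrightarrow> g \<in> A_funs q \<Lambda> \<Longrightarrow> (\<lambda>z. f z + g z) \<in> A_funs q \<Lambda>"
  using B_funs_add has_q_expansion_add unfolding A_funs_def by blast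

lemma A_funs_scale: "f \<in> A_funs q \<Lambda> \<Longrightarrow> (\<lambda>z. c * f z) \<in> A_funs q \<Lambda>"
  using B_funs_scale has_q_expansion_scale unfolding A_funs_def by blast

lemma A_funs_zero:
  assumes "norm q > 1"
  shows "(\<lambda>z. 0) \<in> A_funs q \<Lambda>"
proof -
  have "(\<lambda>z. 0) \<in> B_funs \<Lambda>"
    unfolding B_funs_def by (intro CollectI exI[of _ "1::real"]) (auto simp: bounded_iff)
  moreover have "has_q_expansion q \<Lambda> (\<lambda>z. 0) 0"
    unfolding has_q_expansion_def using assms
    by (intro exI[of _ "1::real"] conjI allI impI ballI)
       (auto simp: q_sector_def intro!: divide_pos_pos mult_pos_pos)
  ultimately show ?thesis unfolding A_funs_def by blast
qed

lemma vectorspace_A_space: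
  assumes "norm q > 1"
  shows "vectorspace class_ring (A_space q \<Lambda>)"
proof -
  have car: "carrier (A_space q \<Lambda>) = q_germ \<Lambda> ` A_funs q \<Lambda>"
    and zero: "\<zero>\<^bsub>A_space q \<Lambda>\<^esub> = q_germ \<Lambda> (\<lambda>z. 0)"
    by (auto simp: A_space_def)
  show ?thesis
  proof (rule vs_criteria)
    show "field (class_ring :: complex ring)" by (rule class_field)
    show "\<zero>\<^bsub>A_space q \<Lambda>\<^esub> \<in> carrier (A_space q \<Lambda>)"
      using A_funs_zero[OF assms] by (auto simp: car zero A_space_add A_space_smult)
    show "\<forall>v\<in>carrier (A_space q \<Lambda>). \<exists>neg_v\<in>carrier (A_space q \<Lambda>). v \<oplus>\<^bsub>A_space q \<Lambda>\<^esub> neg_v = \<zero>\<^bsub>A_space q \<Lambda>\<^esub>"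
    proof
      fix v assume "v \<in> carrier (A_space q \<Lambda>)"
      then obtain f where f: "f \<in> A_funs q \<Lambda>" "v = q_germ \<Lambda> f" by (auto simp: car zero A_space_add A_space_smult)
      show "\<exists>neg_v\<in>carrier (A_space q \<Lambda>). v \<oplus>\<^bsub>A_space q \<Lambda>\<^esub> neg_v = \<zero>\<^bsub>A_space q \<Lambda>\<^esub>"
        using A_funs_scale[OF f(1), of "-1"] f(2)
        by (intro bexI[of _ "q_germ \<Lambda> (\<lambda>z. (-1) * f z)"]) (auto simp: car zero A_space_add A_space_smult)
    qed
  qed (auto simp: car zero A_space_add A_space_smult algebra_simps intro!: imageI A_funs_add A_funs_scale)
qed

section \<open>The space of q-Gevrey series\<close>

text \<open>The asymptotic bound becomes one for all \<open>n\<close> by enlarging the constant, and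
  the power of \<open>norm q\<close> is rewritten in the exponential form of the weights.\<close>

lemma gevrey_carrier_iff:
  assumes "norm q > 1" "\<nu> \<ge> 1"
  shows "a \<in> carrier (q_gevrey_space q (1 / real \<nu>)) \<longleftrightarrow>
    (\<exists>A>0. \<exists>K>0. \<forall>n. norm (fps_nth a n) \<le> K * A ^ n * exp (ln (norm q) / (2 * real \<nu>) * (real n)\<^sup>2))"
proof -
  define L where "L = ln (norm q) / (2 * real \<nu>)"
  have eq: "norm q powr (1 / real \<nu> * real n ^ 2 / 2) = exp (L * (real n)\<^sup>2)" for n
    using assms by (auto simp: powr_def L_def field_simps)
  have "(\<lambda>n. norm (fps_nth a n)) \<in> O(\<lambda>n. A ^ n * exp (L * (real n)\<^sup>2)) \<longleftrightarrow>
      (\<exists>K>0. \<forall>n. norm (fps_nth a n) \<le> K * A ^ n * exp (L * (real n)\<^sup>2))" if A: "A > 0" for A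
  proof
    assume "(\<lambda>n. norm (fps_nth a n)) \<in> O(\<lambda>n. A ^ n * exp (L * (real n)\<^sup>2))"
    then obtain c where c: "c > 0"
      "eventually (\<lambda>n. norm (norm (fps_nth a n)) \<le> c * norm (A ^ n * exp (L * (real n)\<^sup>2))) sequentially"
      by (rule landau_o.bigE)
    then obtain n0 where n0: "\<And>n. n \<ge> n0 \<Longrightarrow> norm (fps_nth a n) \<le> c * (A ^ n * exp (L * (real n)\<^sup>2))"
      using A by (auto simp: eventually_at_top_linorder abs_mult)
    define h where "h = (\<lambda>n. norm (fps_nth a n) / (A ^ n * exp (L * (real n)\<^sup>2)))"
    \<comment> \<open>The sum of the ratios \<open>h\<close> covers the finitely many indices below
      \<open>n0\<close>; \<open>c\<close> covers the rest.\<close>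
    define K where "K = c + sum h {..<n0}"
    have h: "h n \<ge> 0" for n using A by (simp add: h_def)
    have "norm (fps_nth a n) \<le> K * A ^ n * exp (L * (real n)\<^sup>2)" for n
    proof (cases "n \<ge> n0")
      case True
      have "c * (A ^ n * exp (L * (real n)\<^sup>2)) \<le> K * (A ^ n * exp (L * (real n)\<^sup>2))"
        using A h by (intro mult_right_mono) (auto simp: K_def sum_nonneg)
      with n0[OF True] show ?thesis by (simp add: mult.assoc)
    next
      case False
      hence "h n \<le> sum h {..<n0}" by (intro member_le_sum) (auto simp: h)
      hence "h n \<le> K" using c(1) by (simp add: K_def)
      thus ?thesis using A by (simp add: h_def divide_le_eq mult.assoc)
    qed
    moreover have "K > 0" using c(1) h by (simp add: K_def add_pos_nonneg sum_nonneg)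
    ultimately show "\<exists>K>0. \<forall>n. norm (fps_nth a n) \<le> K * A ^ n * exp (L * (real n)\<^sup>2)" by blast
  next
    assume "\<exists>K>0. \<forall>n. norm (fps_nth a n) \<le> K * A ^ n * exp (L * (real n)\<^sup>2)"
    then obtain K where "\<And>n. norm (fps_nth a n) \<le> K * A ^ n * exp (L * (real n)\<^sup>2)" by blast
    thus "(\<lambda>n. norm (fps_nth a n)) \<in> O(\<lambda>n. A ^ n * exp (L * (real n)\<^sup>2))"
      using A by (intro bigoI[of _ K] always_eventually) (auto simp: abs_mult mult.assoc)
  qed
  moreover have "a \<in> carrier (q_gevrey_space q (1 / real \<nu>)) \<longleftrightarrow>
      (\<exists>A>0. (\<lambda>n. norm (fps_nth a n)) \<in> O(\<lambda>n. A ^ n * exp (L * (real n)\<^sup>2)))"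
    unfolding q_gevrey_space_def eq[symmetric] by simp
  ultimately show ?thesis unfolding L_def[symmetric] by (simp cong: conj_cong)
qed

lemma vectorspace_gevrey:
  assumes q: "norm q > 1" and \<nu>: "\<nu> \<ge> 1"
  shows "vectorspace class_ring (q_gevrey_space q (1 / real \<nu>))"
proof -
  define V where "V = q_gevrey_space q (1 / real \<nu>)"
  define g where "g = (\<lambda>n::nat. exp (ln (norm q) / (2 * real \<nu>) * (real n)\<^sup>2))"
  have car: "a \<in> carrier V \<longleftrightarrow> (\<exists>A>0. \<exists>K>0. \<forall>n. norm (fps_nth a n) \<le> K * A ^ n * g n)" for a
    unfolding V_def g_def by (rule gevrey_carrier_iff[OF q \<nu>])
  have ops: "\<zero>\<^bsub>V\<^esub> = 0" "a \<oplus>\<^bsub>V\<^esub> b = a + b" "c \<odot>\<^bsub>V\<^esub> a = fps_const c * a" for a b c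
    by (auto simp: V_def q_gevrey_space_def)
  have scale: "fps_const c * a \<in> carrier V" if a: "a \<in> carrier V" for c a
  proof -
    obtain A K where A: "A > 0" "K > 0" "\<And>n. norm (fps_nth a n) \<le> K * A ^ n * g n"
      using a unfolding car by blast
    have "norm (fps_nth (fps_const c * a) n) \<le> (norm c + 1) * K * A ^ n * g n" for n
    proof -
      have "norm (fps_nth (fps_const c * a) n) \<le> (norm c + 1) * norm (fps_nth a n)"
        by (simp add: norm_mult distrib_right)
      also have "\<dots> \<le> (norm c + 1) * (K * A ^ n * g n)"
        by (intro mult_left_mono A) auto
      finally show ?thesis by (simp add: mult.assoc)
    qed
    moreover have "(norm c + 1) * K > 0" using A by (intro mult_pos_pos add_nonneg_pos) auto
    ultimately show ?thesis unfolding car using A(1) by blast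
  qed
  have add: "a + b \<in> carrier V" if a: "a \<in> carrier V" and b: "b \<in> carrier V" for a b
  proof -
    obtain A K where A: "A > 0" "K > 0" "\<And>n. norm (fps_nth a n) \<le> K * A ^ n * g n"
      using a unfolding car by blast
    obtain B M where B: "B > 0" "M > 0" "\<And>n. norm (fps_nth b n) \<le> M * B ^ n * g n"
      using b unfolding car by blast
    have "norm (fps_nth (a + b) n) \<le> (K + M) * max A B ^ n * g n" for n
    proof -
      have "norm (fps_nth (a + b) n) \<le> norm (fps_nth a n) + norm (fps_nth b n)"
        by (simp add: norm_triangle_ineq)
      also have "\<dots> \<le> K * A ^ n * g n + M * B ^ n * g n" by (intro add_mono A B)
      also have "\<dots> \<le> K * max A B ^ n * g n + M * max A B ^ n * g n"
        using A B by (intro add_mono mult_right_mono mult_left_mono power_mono) (auto simp: g_def)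
      finally show ?thesis by (simp add: distrib_right)
    qed
    moreover have "K + M > 0" "max A B > 0" using A B by auto
    ultimately show ?thesis unfolding car by blast
  qed
  have zero: "0 \<in> carrier V"
    unfolding car by (intro exI[of _ "1::real"] conjI) (auto simp: g_def)
  have "vectorspace class_ring V"
  proof (rule vs_criteria)
    show "field (class_ring :: complex ring)" by (rule class_field)
    show "\<forall>v\<in>carrier V. \<exists>neg_v\<in>carrier V. v \<oplus>\<^bsub>V\<^esub> neg_v = \<zero>\<^bsub>V\<^esub>"
    proof
      fix v assume "v \<in> carrier V"
      from scale[OF this, of "-1"] show "\<exists>neg_v\<in>carrier V. v \<oplus>\<^bsub>V\<^esub> neg_v = \<zero>\<^bsub>V\<^esub>"
        by (intro bexI[of _ "fps_const (-1) * v"]) (auto simp: ops fps_const_neg[symmetric] simp del: fps_const_neg)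
    qed
  qed (auto simp: ops zero add algebra_simps scale[unfolded mult.commute[of "fps_const _"]]
         simp flip: fps_const_add fps_const_mult)
  thus ?thesis by (simp add: V_def)
qed

section \<open>Uniqueness and growth of expansions\<close>

lemma sector_sequence:
  assumes q: "norm q > 1" and \<Lambda>: "q_divisor q \<Lambda>"
  obtains \<epsilon> z where "\<epsilon> > 0" "z \<noteq> 0" "\<forall>R>0. eventually (\<lambda>k. z / q ^ k \<in> q_sector \<Lambda> \<epsilon> R) sequentially"
    "(\<lambda>k. z / q ^ k) \<longlonglongrightarrow> 0"
proof -
  obtain z where z: "z \<noteq> 0" "dq z \<Lambda> > 0" using exists_dq_pos[OF q \<Lambda>] .
  have q0: "q \<noteq> 0" using q by auto
  have "(\<lambda>k. (1 / q) ^ k) \<longlonglongrightarrow> 0"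
    using q by (intro LIMSEQ_power_zero) (auto simp: norm_divide divide_less_eq_1)
  from tendsto_mult_left[OF this, of z] have lim: "(\<lambda>k. z / q ^ k) \<longlonglongrightarrow> 0"
    by (simp add: power_one_over divide_inverse power_inverse)
  \<comment> \<open>Half of \<open>dq z \<Lambda>\<close> is taken because sectors are defined by a
    strict inequality.\<close>
  have "eventually (\<lambda>k. z / q ^ k \<in> q_sector \<Lambda> (dq z \<Lambda> / 2) R) sequentially" if "R > 0" for R
    using tendstoD[OF lim that]
    by eventually_elim (use z q0 dq_div_power_q[OF \<Lambda> q0] in \<open>auto simp: q_sector_def\<close>)
  thus ?thesis using that[of "dq z \<Lambda> / 2" z] z lim by auto
qed

text \<open>At the first index \<open>N\<close> where the series differ, the two remainder estimates
  of order \<open>Suc N\<close> are subtracted and divided by \<open>w ^ N\<close>; the bound tends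
  to 0 along the sequence.\<close>

lemma has_q_expansion_unique:
  assumes q: "norm q > 1" and \<Lambda>: "q_divisor q \<Lambda>"
    and "has_q_expansion q \<Lambda> f a" "has_q_expansion q \<Lambda> f b"
  shows "a = b"
proof (rule ccontr)
  assume "a \<noteq> b"
  let ?G = "\<lambda>N. norm q powr (real N ^ 2 / (2 * real (size \<Lambda>)))"
  define N where "N = (LEAST n. fps_nth a n \<noteq> fps_nth b n)"
  have "\<exists>n. fps_nth a n \<noteq> fps_nth b n" using \<open>a \<noteq> b\<close> by (auto simp: fps_eq_iff)
  hence N: "fps_nth a N \<noteq> fps_nth b N" "\<And>n. n < N \<Longrightarrow> fps_nth a n = fps_nth b n"
    unfolding N_def by (rule LeastI_ex, use not_less_Least in blast)
  obtain C A R where f: "C > 0" "A > 0" "R > 0" "\<forall>\<epsilon>>0. \<forall>N::nat. \<forall>z\<in>q_sector \<Lambda> \<epsilon> R.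
      norm (f z - (\<Sum>n<N. fps_nth a n * z ^ n)) < C / \<epsilon> * A ^ N * ?G N * norm z ^ N"
    by (rule has_q_expansionE[OF assms(3)])
  obtain D B S where g: "D > 0" "B > 0" "S > 0" "\<forall>\<epsilon>>0. \<forall>N::nat. \<forall>z\<in>q_sector \<Lambda> \<epsilon> S.
      norm (f z - (\<Sum>n<N. fps_nth b n * z ^ n)) < D / \<epsilon> * B ^ N * ?G N * norm z ^ N"
    by (rule has_q_expansionE[OF assms(4)])
  obtain \<epsilon> z where z: "\<epsilon> > 0" "z \<noteq> 0" "\<forall>R>0. eventually (\<lambda>k. z / q ^ k \<in> q_sector \<Lambda> \<epsilon> R) sequentially"
    "(\<lambda>k. z / q ^ k) \<longlonglongrightarrow> 0"
    by (rule sector_sequence[OF q \<Lambda>])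
  define K where "K = C / \<epsilon> * A ^ Suc N * ?G (Suc N) + D / \<epsilon> * B ^ Suc N * ?G (Suc N)"
  have ev: "eventually (\<lambda>k. norm (fps_nth a N - fps_nth b N) \<le> K * norm (z / q ^ k)) sequentially"
    using z(3)[rule_format, OF f(3)] z(3)[rule_format, OF g(3)]
  proof eventually_elim
    case (elim k)
    define w where "w = z / q ^ k"
    have "w \<noteq> 0" using z(2) q by (auto simp: w_def)
    have eq: "(\<Sum>n<N. fps_nth a n * w ^ n) = (\<Sum>n<N. fps_nth b n * w ^ n)"
      using N(2) by (intro sum.cong) auto
    have "(fps_nth a N - fps_nth b N) * w ^ N =
        (f w - (\<Sum>n<Suc N. fps_nth b n * w ^ n)) - (f w - (\<Sum>n<Suc N. fps_nth a n * w ^ n))"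
      by (simp add: eq algebra_simps)
    hence "norm (fps_nth a N - fps_nth b N) * norm w ^ N \<le>
        norm (f w - (\<Sum>n<Suc N. fps_nth b n * w ^ n)) + norm (f w - (\<Sum>n<Suc N. fps_nth a n * w ^ n))"
      by (metis norm_mult norm_power norm_triangle_ineq4)
    also have "\<dots> \<le> D / \<epsilon> * B ^ Suc N * ?G (Suc N) * norm w ^ Suc N + C / \<epsilon> * A ^ Suc N * ?G (Suc N) * norm w ^ Suc N"
      using elim f(4)[rule_format, OF z(1), of w "Suc N"] g(4)[rule_format, OF z(1), of w "Suc N"] unfolding w_def by linarith
    also have "\<dots> = (K * norm w) * norm w ^ N"
      by (simp add: K_def algebra_simps)
    finally show ?case using \<open>w \<noteq> 0\<close> by (simp add: w_def[symmetric])
  qed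
  have "(\<lambda>k. K * norm (z / q ^ k)) \<longlonglongrightarrow> K * 0"
    using tendsto_norm[OF z(4)] by (intro tendsto_mult tendsto_const) simp
  from tendsto_lowerbound[OF this ev] have "norm (fps_nth a N - fps_nth b N) \<le> 0" by simp
  with N(1) show False by simp
qed

text \<open>A single point of a sector suffices: \<open>fps_nth a n * z ^ n\<close> is the
  difference of two consecutive remainders there.\<close>

lemma has_q_expansion_imp_gevrey:
  assumes q: "norm q > 1" and \<Lambda>: "q_divisor q \<Lambda>" and \<nu>: "size \<Lambda> \<ge> 1"
    and f: "has_q_expansion q \<Lambda> f a"
  shows "a \<in> carrier (q_gevrey_space q (1 / real (size \<Lambda>)))"
proof -
  define \<nu> where "\<nu> = size \<Lambda>"
  define L where "L = ln (norm q) / (2 * real \<nu>)"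
  have L: "L > 0" using q \<nu> unfolding L_def \<nu>_def by (intro divide_pos_pos ln_gt_zero) auto
  have G: "norm q powr (real N ^ 2 / (2 * real (size \<Lambda>))) = exp (L * (real N)\<^sup>2)" for N
    using q by (auto simp: powr_def L_def \<nu>_def)
  obtain C A R where f: "C > 0" "A > 0" "R > 0" "\<forall>\<epsilon>>0. \<forall>N::nat. \<forall>z\<in>q_sector \<Lambda> \<epsilon> R.
      norm (f z - (\<Sum>n<N. fps_nth a n * z ^ n)) < C / \<epsilon> * A ^ N * exp (L * (real N)\<^sup>2) * norm z ^ N"
    by (rule has_q_expansionE[OF f, unfolded G])
  obtain \<epsilon> z where z: "\<epsilon> > 0" "z \<noteq> 0" "z \<in> q_sector \<Lambda> \<epsilon> R"
  proof -
    obtain \<epsilon> y where y: "\<epsilon> > 0" "y \<noteq> 0" "\<forall>R>0. eventually (\<lambda>k. y / q ^ k \<in> q_sector \<Lambda> \<epsilon> R) sequentially"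
      by (rule sector_sequence[OF q \<Lambda>])
    obtain k where k: "y / q ^ k \<in> q_sector \<Lambda> \<epsilon> R"
      using eventually_happens[OF y(3)[rule_format, OF f(3)]] by auto
    hence "y / q ^ k \<noteq> 0" by (simp add: q_sector_def)
    thus ?thesis using that y(1) k by blast
  qed
  \<comment> \<open>\<open>B ^ n\<close> is the growth of the Gaussian factor from \<open>n\<close>
    to \<open>Suc n\<close>, apart from the constant \<open>exp L\<close>.\<close>
  define B where "B = exp (2 * L)"
  define K where "K = C / \<epsilon> * (1 + A * exp L * norm z)"
  have "norm (fps_nth a n) \<le> K * (A * B) ^ n * exp (L * (real n)\<^sup>2)" for n
  proof -
    have B: "B \<ge> 1" using L by (simp add: B_def)
    have step: "exp (L * (real (Suc n))\<^sup>2) = exp L * B ^ n * exp (L * (real n)\<^sup>2)"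
      unfolding B_def exp_of_nat_mult[symmetric] exp_add[symmetric]
      by (rule arg_cong[of _ _ exp]) (simp add: power2_eq_square algebra_simps)
    have "fps_nth a n * z ^ n = (f z - (\<Sum>i<n. fps_nth a i * z ^ i)) - (f z - (\<Sum>i<Suc n. fps_nth a i * z ^ i))"
      by simp
    hence "norm (fps_nth a n) * norm z ^ n \<le>
        norm (f z - (\<Sum>i<n. fps_nth a i * z ^ i)) + norm (f z - (\<Sum>i<Suc n. fps_nth a i * z ^ i))"
      by (metis norm_mult norm_power norm_triangle_ineq4)
    also have "\<dots> \<le> C / \<epsilon> * A ^ n * exp (L * (real n)\<^sup>2) * norm z ^ n +
        C / \<epsilon> * A ^ Suc n * exp (L * (real (Suc n))\<^sup>2) * norm z ^ Suc n"
      using f(4)[rule_format, OF z(1,3), of n] f(4)[rule_format, OF z(1,3), of "Suc n"] by linarith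
    also have "\<dots> = (C / \<epsilon> * (1 + A * exp L * norm z * B ^ n) * A ^ n * exp (L * (real n)\<^sup>2)) * norm z ^ n"
      unfolding step by (simp add: algebra_simps)
    finally have "norm (fps_nth a n) \<le> C / \<epsilon> * (1 + A * exp L * norm z * B ^ n) * A ^ n * exp (L * (real n)\<^sup>2)"
      by (rule mult_right_le_imp_le) (use z(2) in simp)
    also have "\<dots> \<le> C / \<epsilon> * (B ^ n + A * exp L * norm z * B ^ n) * A ^ n * exp (L * (real n)\<^sup>2)"
      using f(1,2) z(1) B by (intro mult_right_mono mult_left_mono add_mono) auto
    also have "\<dots> = K * (A * B) ^ n * exp (L * (real n)\<^sup>2)"
      by (simp add: K_def power_mult_distrib algebra_simps)
    finally show ?thesis .
  qed
  moreover have "A * B > 0" using f(2) by (simp add: B_def)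
  moreover have "K > 0" using f(1,2) z(1) unfolding K_def by (intro mult_pos_pos add_pos_nonneg) auto
  ultimately show ?thesis
    using gevrey_carrier_iff[OF q \<nu>, of a] unfolding L_def \<nu>_def by blast
qed

text \<open>Expansions carry over between representatives and are unique, so the definite
  description in \<open>J\<close> has a value computable from any representative.\<close>

lemma J_eq:
  assumes q: "norm q > 1" and \<Lambda>: "q_divisor q \<Lambda>" and f: "has_q_expansion q \<Lambda> f a"
  shows "J q \<Lambda> (q_germ \<Lambda> f) = a"
  unfolding J_def
proof (rule the_equality)
  show "\<exists>g\<in>q_germ \<Lambda> f. has_q_expansion q \<Lambda> g a" using f q_germ_refl by blast
  fix b assume "\<exists>g\<in>q_germ \<Lambda> f. has_q_expansion q \<Lambda> g b"
  then obtain g where "g \<in> q_germ \<Lambda> f" "has_q_expansion q \<Lambda> g b" by blast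
  hence "has_q_expansion q \<Lambda> f b" using has_q_expansion_germ q_germ_sym by blast
  thus "b = a" using has_q_expansion_unique[OF q \<Lambda>] f by blast
qed

section \<open>Surjectivity and conclusion\<close>

lemma borel_ritt_surjective:
  assumes q: "norm q > 1" and \<Lambda>: "q_divisor q \<Lambda>" and \<nu>: "size \<Lambda> \<ge> 1"
    and a: "a \<in> carrier (q_gevrey_space q (1 / real (size \<Lambda>)))"
  obtains f where "f \<in> B_funs \<Lambda>" "has_q_expansion q \<Lambda> f a"
proof -
  define L where "L = ln (norm q) / (2 * real (size \<Lambda>))"
  have q0: "q \<noteq> 0" using q by auto
  obtain A K where A: "A > 0" "K > 0" "\<And>n. norm (fps_nth a n) \<le> K * A ^ n * exp (L * (real n)\<^sup>2)"
    using a unfolding gevrey_carrier_iff[OF q \<nu>] L_def by blast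
  from divisor_theta[OF q \<Lambda>] obtain c t \<delta> where t: "c \<noteq> 0"
    "\<And>k. q powi k * t k = c * t (k - int (size \<Lambda>))" "\<delta> > 0"
    "\<And>z. z \<noteq> 0 \<Longrightarrow> \<delta> * dq z \<Lambda> \<le> norm (\<Sum>\<^sub>\<infinity>k. t k * z powi k)" by blast
  define b where "b = ln (norm c) / real (size \<Lambda>) - ln (norm q) / 2"
  interpret theta_recurrence q c "size \<Lambda>" t b L
    by unfold_locales (use q t \<nu> in \<open>auto simp: b_def L_def\<close>)
  \<comment> \<open>The bound from \<open>divisor_theta\<close> lacks \<open>Theta\<close>; its
    restriction to the annulus between 1 and \<open>norm q\<close> yields the weighted one.\<close>
  have "\<exists>\<delta>'>0. \<forall>z. z \<noteq> 0 \<longrightarrow> \<delta>' * dq z \<Lambda> * Theta b L (norm z) \<le> norm (\<Sum>\<^sub>\<infinity>k. t k * z powi k)"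
  proof (rule lower_bound_from_annulus[of "\<lambda>z. dq z \<Lambda>" 1 \<delta>])
    fix z :: complex assume "1 \<le> norm z"
    hence "z \<noteq> 0" by auto
    thus "\<delta> * dq z \<Lambda> \<le> norm (\<Sum>\<^sub>\<infinity>k. t k * z powi k)" by (rule t(4))
  qed (use t(3) dq_mult_q[OF \<Lambda> q0] dq_nonneg[OF \<Lambda>] in auto)
  then obtain \<delta>' where \<delta>': "\<delta>' > 0"
    "\<And>z. z \<noteq> 0 \<Longrightarrow> \<delta>' * dq z \<Lambda> * Theta b L (norm z) \<le> norm (\<Sum>\<^sub>\<infinity>k. t k * z powi k)" by blast
  from truncated_product_quotient[OF A(3,2,1) \<delta>']
  obtain f B E where f: "B > 0" "E > 0" "f analytic_on {z. z \<noteq> 0 \<and> dq z \<Lambda> > 0}"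
    "\<And>z N. z \<noteq> 0 \<Longrightarrow> dq z \<Lambda> > 0 \<Longrightarrow>
      norm (f z - (\<Sum>n<N. fps_nth a n * z ^ n)) \<le> B / dq z \<Lambda> * E ^ N * exp (L * (real N)\<^sup>2) * norm z ^ N"
    by blast
  \<comment> \<open>The strict inequality comes from \<open>dq z \<Lambda> > \<epsilon>\<close>. The
    constants do not depend on the radius \<open>R\<close>.\<close>
  have bound: "norm (f z - (\<Sum>n<N. fps_nth a n * z ^ n)) <
      B / \<epsilon> * E ^ N * norm q powr (real N ^ 2 / (2 * real (size \<Lambda>))) * norm z ^ N"
    if "\<epsilon> > 0" "z \<in> q_sector \<Lambda> \<epsilon> R" for \<epsilon> R N z
  proof -
    have z: "z \<noteq> 0" "dq z \<Lambda> > \<epsilon>" using that by (auto simp: q_sector_def)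
    have "norm (f z - (\<Sum>n<N. fps_nth a n * z ^ n)) \<le>
        B / dq z \<Lambda> * E ^ N * exp (L * (real N)\<^sup>2) * norm z ^ N"
      using z that(1) by (intro f(4)) auto
    also have "\<dots> < B / \<epsilon> * E ^ N * exp (L * (real N)\<^sup>2) * norm z ^ N"
      using z that(1) f(1,2)
      by (intro mult_strict_right_mono divide_strict_left_mono) auto
    also have "exp (L * (real N)\<^sup>2) = norm q powr (real N ^ 2 / (2 * real (size \<Lambda>)))"
      using q0 by (simp add: powr_def L_def)
    finally show ?thesis .
  qed
  show ?thesis
  proof (rule that)
    show "has_q_expansion q \<Lambda> f a"
      unfolding has_q_expansion_def using f(1,2) bound
      by (intro exI[of _ B] exI[of _ E] exI[of _ "1::real"] conjI allI impI ballI) auto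
    have "f analytic_on q_sector \<Lambda> 0 1"
      by (rule analytic_on_subset[OF f(3)]) (auto simp: q_sector_def)
    \<comment> \<open>The estimate with \<open>N = 0\<close> bounds \<open>f\<close> by
      \<open>B / \<epsilon>\<close>.\<close>
    moreover have "bounded (f ` q_sector \<Lambda> \<epsilon> r)" if "\<epsilon> > 0" for \<epsilon> r
      unfolding bounded_iff using bound[OF that, of _ r 0] q0
      by (intro exI[of _ "B / \<epsilon>"]) (auto intro: less_imp_le)
    ultimately show "f \<in> B_funs \<Lambda>"
      unfolding B_funs_def by (intro CollectI exI[of _ "1::real"]) auto
  qed
qed

theorem theorem5p3p3:
  fixes q :: complex and \<Lambda> :: "complex set multiset"
  assumes "norm q > 1"
    and "q_divisor q \<Lambda>"
    and "size \<Lambda> \<ge> 1"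
  shows "(\<forall>F \<in> carrier (A_space q \<Lambda>). \<exists>!a. \<exists>f\<in>F. has_q_expansion q \<Lambda> f a) \<and>
    linear_map class_ring (A_space q \<Lambda>) (q_gevrey_space q (1 / real (size \<Lambda>))) (J q \<Lambda>) \<and>
    J q \<Lambda> ` carrier (A_space q \<Lambda>) = carrier (q_gevrey_space q (1 / real (size \<Lambda>)))"
proof (intro conjI)
  define V where "V = A_space q \<Lambda>"
  define W where "W = q_gevrey_space q (1 / real (size \<Lambda>))"
  \<comment> \<open>Elements of the carrier are germs, so every computation with \<open>J\<close>
    goes through a representative and its expansion.\<close>
  have rep: "\<exists>f a. f \<in> A_funs q \<Lambda> \<and> F = q_germ \<Lambda> f \<and> has_q_expansion q \<Lambda> f a \<and> J q \<Lambda> F = a"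
    if "F \<in> carrier V" for F
    using that J_eq[OF assms(1,2)] by (auto simp: V_def A_space_def A_funs_def)
  show "\<forall>F \<in> carrier (A_space q \<Lambda>). \<exists>!a. \<exists>f\<in>F. has_q_expansion q \<Lambda> f a"
  proof
    fix F assume "F \<in> carrier (A_space q \<Lambda>)"
    then obtain f a where f: "F = q_germ \<Lambda> f" "has_q_expansion q \<Lambda> f a"
      using rep unfolding V_def by blast
    show "\<exists>!a. \<exists>f\<in>F. has_q_expansion q \<Lambda> f a"
    proof (rule ex1I[of _ a])
      show "\<exists>f\<in>F. has_q_expansion q \<Lambda> f a" using f q_germ_refl by blast
      fix b assume "\<exists>g\<in>F. has_q_expansion q \<Lambda> g b"
      then obtain g where "g \<in> q_germ \<Lambda> f" "has_q_expansion q \<Lambda> g b" using f(1) by blast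
      hence "has_q_expansion q \<Lambda> f b" using has_q_expansion_germ q_germ_sym by blast
      thus "b = a" using has_q_expansion_unique[OF assms(1,2)] f(2) by blast
    qed
  qed
  have J_in: "J q \<Lambda> F \<in> carrier W" if F: "F \<in> carrier V" for F
    using rep[OF F] has_q_expansion_imp_gevrey[OF assms] unfolding W_def by blast
  have "J q \<Lambda> (F \<oplus>\<^bsub>V\<^esub> G) = J q \<Lambda> F \<oplus>\<^bsub>W\<^esub> J q \<Lambda> G"
    if F: "F \<in> carrier V" and G: "G \<in> carrier V" for F G
  proof -
    obtain f a where f: "F = q_germ \<Lambda> f" "has_q_expansion q \<Lambda> f a" "J q \<Lambda> F = a"
      using rep[OF F] by blast
    obtain g b where g: "G = q_germ \<Lambda> g" "has_q_expansion q \<Lambda> g b" "J q \<Lambda> G = b"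
      using rep[OF G] by blast
    have "J q \<Lambda> (F \<oplus>\<^bsub>V\<^esub> G) = a + b"
      unfolding V_def f(1) g(1) A_space_add
      by (rule J_eq[OF assms(1,2) has_q_expansion_add[OF f(2) g(2)]])
    thus ?thesis using f(3) g(3) by (simp add: W_def q_gevrey_space_def)
  qed
  moreover have "J q \<Lambda> (c \<odot>\<^bsub>V\<^esub> F) = c \<odot>\<^bsub>W\<^esub> J q \<Lambda> F" if F: "F \<in> carrier V" for c F
  proof -
    obtain f a where f: "F = q_germ \<Lambda> f" "has_q_expansion q \<Lambda> f a" "J q \<Lambda> F = a"
      using rep[OF F] by blast
    have "J q \<Lambda> (c \<odot>\<^bsub>V\<^esub> F) = fps_const c * a"
      unfolding V_def f(1) A_space_smult
      by (rule J_eq[OF assms(1,2) has_q_expansion_scale[OF f(2)]])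
    thus ?thesis using f(3) by (simp add: W_def q_gevrey_space_def)
  qed
  ultimately have hom: "J q \<Lambda> \<in> LinearCombinations.module_hom class_ring V W"
    using J_in by (auto simp: LinearCombinations.module_hom_def)
  have vs: "vectorspace class_ring V" "vectorspace class_ring W"
    unfolding V_def W_def using vectorspace_A_space vectorspace_gevrey assms by blast+
  thus "linear_map class_ring (A_space q \<Lambda>) (q_gevrey_space q (1 / real (size \<Lambda>))) (J q \<Lambda>)"
    using hom unfolding V_def W_def
    by (simp add: linear_map_def mod_hom_def mod_hom_axioms_def vectorspace_def)
  have "a \<in> J q \<Lambda> ` carrier V" if a: "a \<in> carrier W" for a
  proof -
    obtain f where "f \<in> B_funs \<Lambda>" "has_q_expansion q \<Lambda> f a"
      by (rule borel_ritt_surjective[OF assms a[unfolded W_def]])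
    hence "q_germ \<Lambda> f \<in> carrier V" "J q \<Lambda> (q_germ \<Lambda> f) = a"
      using J_eq[OF assms(1,2)] by (auto simp: V_def A_space_def A_funs_def)
    thus ?thesis by blast
  qed
  thus "J q \<Lambda> ` carrier (A_space q \<Lambda>) = carrier (q_gevrey_space q (1 / real (size \<Lambda>)))"
    using J_in unfolding V_def W_def by blast
qed

end
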